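(* Let $\mathcal{S}=\mathcal{R}$ be one of the sets $\mathcal{R}_H,\mathcal{R}'_H,\mathcal{R}''_H$ for a subgroup $H=\{A_\lambda:\lambda\in V_3\}$ with $\mathbb{P}V_3$ of kind $\mathcal{P}_0$ (so $\mathcal{S}$ is a Segre variety $\mathcal{S}_3(2)$ in $\omega_4$), and let $\mathcal{R}$ be one of $\mathcal{R}_{K},\mathcal{R}'_{K},\mathcal{R}''_{K}$ for a subgroup $K\cong(Z_3)^3$ of $\mathcal{G}_{81}$ with $K\neq H$. Then the section $\mathcal{S}\cap\mathcal{R}$ is either (i) an $\mathcal{S}_2(2)$ contained in $\mathcal{S}$, or (ii) a $3$-generator set of $\mathcal{S}$, or (iii) a fan of $\mathcal{S}$.
   Context: Work over $\mathbb{F}_2$. $V_8=V(8,2)$ with basis $e_1,\dots,e_8$, $V_a=\langle e_1,e_8\rangle$, $V_b=\langle e_2,e_7\rangle$, $V_c=\langle e_3,e_6\rangle$, $V_d=\langle e_4,e_5\rangle$; points of $\operatorname{PG}(7,2)$ are nonzero vectors; $\omega_4$ is the set of vectors all four of whose components in $V_a,\dots,V_d$ are nonzero. Let $\zeta_a: e_1\mapsto e_8\mapsto e_1+e_8\mapsto e_1$, $\zeta_b: e_7\mapsto e_2\mapsto e_2+e_7\mapsto e_7$, $\zeta_c: e_3\mapsto e_6\mapsto e_3+e_6\mapsto e_3$, $\zeta_d: e_5\mapsto e_4\mapsto e_4+e_5\mapsto e_5$. For $\lambda=ijkl\in\mathbb{F}_3^4$ let $A_\lambda=\zeta_a^i\oplus\zeta_b^j\oplus\zeta_c^k\oplus\zeta_d^l$;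 these form $\mathcal{G}_{81}\cong(Z_3)^4$. Let $u=e_1+\dots+e_8$. For $H\cong(Z_3)^3$ in $\mathcal{G}_{81}$ with cosets $H,H',H''$ set $\mathcal{R}_H=\{hu:h\in H\}$, $\mathcal{R}'_H=\{hu:h\in H'\}$, $\mathcal{R}''_H=\{hu:h\in H''\}$. A plane $\mathbb{P}V_3$ of $\operatorname{PG}(3,3)=\mathbb{P}\mathbb{F}_3^4$ is of kind $\mathcal{P}_0$ if it contains none of $\langle1000\rangle,\langle0100\rangle,\langle0010\rangle,\langle0001\rangle$. A Segre variety $\mathcal{S}_3(2)$ is the image under a linear isomorphism $\phi:V(2,2)^{\otimes3}\to V_8$ of the set $\{x\otimes y\otimes z\}$ of nonzero pure tensors; its generators are the $27$ lines $\{\phi(v\otimes y\otimes z):v\neq0\}$, $\{\phi(x\otimes v\otimes z)\}$, $\{\phi(x\otimes y\otimes v)\}$. In these terms: an $\mathcal{S}_2(2)$ in $\mathcal{S}$ is a $9$-set of the form $\{\phi(x\otimes y\otimes z_0)\}$ with $z_0$ fixed (or the analogous set with another factor fixed); a $3$-generator set is a $9$-set $\{\phi(x_r\otimes y_r\otimes z): r=1,2,3,\ z\neq0\}$ where $x_1,x_2,x_3$ are distinct and $y_1,y_2,y_3$ are distinct (or the analogue with the factors permuted), i.e. three parallel generators meeting a perpendicular $\mathcal{S}_2(2)$ in three points no two on a common generator of it; a fan is a $9$-subset of $\mathcal{S}$ no two of whose points lie on a common generator. *)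

theory Defs
  imports
    "HOL-Analysis.Cartesian_Space"
    "HOL-Library.Z2"
    "HOL-Algebra.Elementary_Groups"
begin

(* The prime field of order 3.  The library's numeral type 3 is only an instance of
   comm_ring_1, whereas vec.subspace and vec.dim need class field. *)

datatype f3 = F0 | F1 | F2

fun f3_nat :: "f3 \<Rightarrow> nat" where
  "f3_nat F0 = 0"
| "f3_nat F1 = 1"
| "f3_nat F2 = 2"

definition nat_f3 :: "nat \<Rightarrow> f3" where
  "nat_f3 n = (if n mod 3 = 0 then F0 else if n mod 3 = 1 then F1 else F2)"

instantiation f3 :: field
begin

definition zero_f3_def: "(0 :: f3) = F0"
definition one_f3_def: "(1 :: f3) = F1"
definition plus_f3_def: "x + y = nat_f3 (f3_nat x + f3_nat y)" for x y :: f3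
definition times_f3_def: "x * y = nat_f3 (f3_nat x * f3_nat y)" for x y :: f3
definition uminus_f3_def: "- x = nat_f3 (2 * f3_nat x)" for x :: f3
definition minus_f3_def: "x - y = nat_f3 (f3_nat x + 2 * f3_nat y)" for x y :: f3
(* every nonzero element is its own inverse *)
definition inverse_f3_def: "inverse x = x" for x :: f3
definition divide_f3_def: "x div y = nat_f3 (f3_nat x * f3_nat y)" for x y :: f3

instance
proof
  fix a b c :: f3
  note defs = zero_f3_def one_f3_def plus_f3_def times_f3_def uminus_f3_def minus_f3_def
    inverse_f3_def divide_f3_def nat_f3_def
  show "a * b * c = a * (b * c)" by (cases a; cases b; cases c; simp add: defs)
  show "a * b = b * a" by (cases a; cases b; simp add: defs)
  show "1 * a = a" by (cases a; simp add: defs)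
  show "a + b + c = a + (b + c)" by (cases a; cases b; cases c; simp add: defs)
  show "a + b = b + a" by (cases a; cases b; simp add: defs)
  show "0 + a = a" by (cases a; simp add: defs)
  show "- a + a = 0" by (cases a; simp add: defs)
  show "a - b = a + - b" by (cases a; cases b; simp add: defs)
  show "(a + b) * c = a * c + b * c" by (cases a; cases b; cases c; simp add: defs)
  show "(0 :: f3) \<noteq> 1" by (simp add: defs)
  show "a \<noteq> 0 \<Longrightarrow> inverse a * a = 1" by (cases a; simp add: defs)
  show "a div b = a * inverse b" by (simp add: defs)
  show "inverse (0 :: f3) = 0" by (simp add: defs)
qed

end

(* V(8,2), with basis e 1, ..., e 8.  The index type 8 is arithmetic modulo 8, so e 8 = e 0;
   the eight indices 1, ..., 8 are distinct and exhaust the type. *)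

type_synonym V8 = "bit ^ 8"

definition e :: "8 \<Rightarrow> V8" where
  "e i = axis i 1"

definition u :: V8 where
  "u = e 1 + e 2 + e 3 + e 4 + e 5 + e 6 + e 7 + e 8"

(* component p q is the projection onto <e p, e q> along the other basis vectors, and
   zeta p q is the linear map e p |-> e q |-> e p + e q |-> e p of <e p, e q>, preceded by
   that projection.  Thus zeta_a, zeta_b, zeta_c, zeta_d are zeta 1 8, zeta 7 2, zeta 3 6,
   zeta 5 4, each acting on its own summand of V8 = V_a + V_b + V_c + V_d. *)

definition component :: "8 \<Rightarrow> 8 \<Rightarrow> V8 \<Rightarrow> V8" where
  "component p q v = v $ p *s e p + v $ q *s e q"

definition zeta :: "8 \<Rightarrow> 8 \<Rightarrow> V8 \<Rightarrow> V8" where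
  "zeta p q v = v $ p *s e q + v $ q *s (e p + e q)"

definition omega4 :: "V8 set" where
  "omega4 = {v. component 1 8 v \<noteq> 0 \<and> component 2 7 v \<noteq> 0 \<and>
                component 3 6 v \<noteq> 0 \<and> component 4 5 v \<noteq> 0}"

definition A :: "f3 ^ 4 \<Rightarrow> V8 \<Rightarrow> V8" where
  "A l v = (zeta 1 8 ^^ f3_nat (l $ 1)) (component 1 8 v)
         + (zeta 7 2 ^^ f3_nat (l $ 2)) (component 7 2 v)
         + (zeta 3 6 ^^ f3_nat (l $ 3)) (component 3 6 v)
         + (zeta 5 4 ^^ f3_nat (l $ 4)) (component 5 4 v)"

definition G81 :: "(V8 \<Rightarrow> V8) monoid" where
  "G81 = \<lparr>carrier = range A, mult = (\<circ>), one = id\<rparr>"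

definition is_Z3_cubed :: "(V8 \<Rightarrow> V8) set \<Rightarrow> bool" where
  "is_Z3_cubed H \<longleftrightarrow> subgroup H G81 \<and>
     G81\<lparr>carrier := H\<rparr> \<cong>
       integer_mod_group 3 \<times>\<times> integer_mod_group 3 \<times>\<times> integer_mod_group 3"

(* The three sets R_H, R'_H, R''_H. *)
definition coset_orbits :: "(V8 \<Rightarrow> V8) set \<Rightarrow> V8 set set" where
  "coset_orbits H = {(\<lambda>h. h u) ` C | C. C \<in> rcosets\<^bsub>G81\<^esub> H}"

definition kind_P0 :: "(f3 ^ 4) set \<Rightarrow> bool" where
  "kind_P0 V3 \<longleftrightarrow> vec.subspace V3 \<and> vec.dim V3 = 3 \<and> (\<forall>i. axis i 1 \<notin> V3)"

(* The threefold tensor power of V(2,2), modelled by its coordinate arrays. *)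

type_synonym V2 = "bit ^ 2"
type_synonym V2_cubed = "bit ^ (2 \<times> 2 \<times> 2)"

definition tensor3 :: "V2 \<Rightarrow> V2 \<Rightarrow> V2 \<Rightarrow> V2_cubed" where
  "tensor3 x y z = (\<chi> p. case p of (i, j, k) \<Rightarrow> x $ i * y $ j * z $ k)"

definition segre_image :: "(V2_cubed \<Rightarrow> V8) \<Rightarrow> V8 set" where
  "segre_image \<phi> = {\<phi> (tensor3 x y z) | x y z. x \<noteq> 0 \<and> y \<noteq> 0 \<and> z \<noteq> 0}"

definition segre_param :: "(V2_cubed \<Rightarrow> V8) \<Rightarrow> V8 set \<Rightarrow> bool" where
  "segre_param \<phi> S \<longleftrightarrow>
     Vector_Spaces.linear (*s) (*s) \<phi> \<and> bij \<phi> \<and> S = segre_image \<phi>"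

definition generators :: "(V2_cubed \<Rightarrow> V8) \<Rightarrow> V8 set set" where
  "generators \<phi> =
     {{\<phi> (tensor3 v y z) | v. v \<noteq> 0} | y z. y \<noteq> 0 \<and> z \<noteq> 0} \<union>
     {{\<phi> (tensor3 x v z) | v. v \<noteq> 0} | x z. x \<noteq> 0 \<and> z \<noteq> 0} \<union>
     {{\<phi> (tensor3 x y v) | v. v \<noteq> 0} | x y. x \<noteq> 0 \<and> y \<noteq> 0}"

definition is_S2 :: "(V2_cubed \<Rightarrow> V8) \<Rightarrow> V8 set \<Rightarrow> bool" where
  "is_S2 \<phi> X \<longleftrightarrow>
     (\<exists>x. x \<noteq> 0 \<and> X = {\<phi> (tensor3 x y z) | y z. y \<noteq> 0 \<and> z \<noteq> 0}) \<or>
     (\<exists>y. y \<noteq> 0 \<and> X = {\<phi> (tensor3 x y z) | x z. x \<noteq> 0 \<and> z \<noteq> 0}) \<or>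
     (\<exists>z. z \<noteq> 0 \<and> X = {\<phi> (tensor3 x y z) | x y. x \<noteq> 0 \<and> y \<noteq> 0})"

definition three_points :: "(nat \<Rightarrow> V2) \<Rightarrow> bool" where
  "three_points x \<longleftrightarrow> inj_on x {1..3} \<and> (\<forall>r\<in>{1..3}. x r \<noteq> 0)"

definition is_three_generator_set :: "(V2_cubed \<Rightarrow> V8) \<Rightarrow> V8 set \<Rightarrow> bool" where
  "is_three_generator_set \<phi> X \<longleftrightarrow>
     (\<exists>x y. three_points x \<and> three_points y \<and>
        (X = {\<phi> (tensor3 v (x r) (y r)) | r v. r \<in> {1..3} \<and> v \<noteq> 0} \<or>
         X = {\<phi> (tensor3 (x r) v (y r)) | r v. r \<in> {1..3} \<and> v \<noteq> 0} \<or>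
         X = {\<phi> (tensor3 (x r) (y r) v) | r v. r \<in> {1..3} \<and> v \<noteq> 0}))"

definition is_fan :: "(V2_cubed \<Rightarrow> V8) \<Rightarrow> V8 set \<Rightarrow> bool" where
  "is_fan \<phi> X \<longleftrightarrow> X \<subseteq> segre_image \<phi> \<and> card X = 9 \<and>
     (\<forall>p\<in>X. \<forall>q\<in>X. p \<noteq> q \<longrightarrow> \<not> (\<exists>g\<in>generators \<phi>. p \<in> g \<and> q \<in> g))"

end

theory Submission
  imports Defs
begin

text \<open>
  Write \<open>Q l = A l u\<close>.  The four summands of V8 are copies of the field of order 4 on which
  \<open>A l\<close> multiplies by a nonzero scalar, so \<open>Q l + Q (l + d) + Q (l - d) = 0\<close> whenever \<open>d\<close> has no
  zero coordinate.  If \<open>V3\<close> is the kernel of a functional \<open>f\<close> with nonzero coefficients, then \<open>V3\<close>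
  contains exactly three such directions up to sign, and they form a basis; in the resulting
  affine coordinates on a coset, \<open>Q\<close> extends to a linear isomorphism that maps the pure tensors
  onto \<open>S\<close>.  Two points of \<open>S\<close> lie on a common generator iff their sum is again in \<open>S\<close>, iff their
  coordinate triples have Hamming distance 1; this is intrinsic to \<open>S\<close>, and since an isometry of
  the Hamming space only permutes coordinates and relabels their values, every other
  parametrisation of \<open>S\<close> has the same coordinates up to such changes.  The section with \<open>R\<close> is
  an affine plane in the coordinates, and the three cases correspond to its equation involving
  one, two or three of them.
\<close>

subsection \<open>Isometries of Hamming spaces\<close>

definition hamming :: "('i::finite \<Rightarrow> 'a) \<Rightarrow> ('i \<Rightarrow> 'a) \<Rightarrow> nat" where
  "hamming s t = card {i. s i \<noteq> t i}"

lemma hamming_1E: assumes "hamming s t = 1" obtains n where "\<And>i. s i \<noteq> t i \<longleftrightarrow> i = n"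
proof -
  obtain n where "{i. s i \<noteq> t i} = {n}" using assms unfolding hamming_def by (auto simp: card_1_singleton_iff)
  then have "\<And>i. s i \<noteq> t i \<longleftrightarrow> i = n" by auto
  then show ?thesis using that by blast
qed

text \<open>
  The points closer to one end of an edge than to the other form a coordinate hyperplane: this
  recovers the coordinates from the distance alone.
\<close>

lemma hamming_less_iff:
  assumes "\<And>i. p i \<noteq> q i \<longleftrightarrow> i = n"
  shows "hamming s p < hamming s q \<longleftrightarrow> s n = p n"
proof -
  have pq: "p i = q i" if "i \<noteq> n" for i using assms that by blast
  have "p n \<noteq> q n" using assms by blast
  define B where "B = {i. i \<noteq> n \<and> s i \<noteq> p i}"
  have B: "finite B" "n \<notin> B" by (auto simp: B_def)
  have B': "B = {i. i \<noteq> n \<and> s i \<noteq> q i}" unfolding B_def using pq by metis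
  have 1: "{i. s i \<noteq> p i} = (if s n = p n then B else insert n B)"
    unfolding B_def by auto
  have 2: "{i. s i \<noteq> q i} = (if s n = q n then B else insert n B)"
    unfolding B' by auto
  show ?thesis unfolding hamming_def 1 2 using \<open>p n \<noteq> q n\<close> B by (auto simp: card_insert_if)
qed

text \<open>If the pairs \<open>a\<close>, \<open>b\<close> and \<open>a\<close>, \<open>c\<close>
  had different directions, the images of \<open>b\<close> and \<open>c\<close> would differ in two
  coordinates, although distinct arguments give images that differ in exactly one.\<close>

lemma common_direction:
  assumes *: "\<And>a b :: 'a. a \<noteq> b \<Longrightarrow> \<exists>n. \<forall>i. F a i \<noteq> F b i \<longleftrightarrow> i = n" and two: "a0 \<noteq> (a1 :: 'a)"
  shows "\<exists>n. \<forall>a b. a \<noteq> b \<longrightarrow> (\<forall>i. F a i \<noteq> F b i \<longleftrightarrow> i = n)"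
proof -
  obtain n where n: "\<forall>i. F a0 i \<noteq> F a1 i \<longleftrightarrow> i = n" using *[OF two] ..
  have step: "\<forall>i. F a i \<noteq> F c i \<longleftrightarrow> i = k"
    if k: "\<forall>i. F a i \<noteq> F b i \<longleftrightarrow> i = k" and ab: "a \<noteq> b" "a \<noteq> c" for a b c k
  proof (cases "b = c")
    case False
    obtain k' where "\<forall>i. F a i \<noteq> F c i \<longleftrightarrow> i = k'" using *[OF ab(2)] ..
    moreover obtain k'' where "\<forall>i. F b i \<noteq> F c i \<longleftrightarrow> i = k''" using *[OF False] ..
    ultimately show ?thesis using k by metis
  qed (use k in simp)
  have "\<forall>i. F a i \<noteq> F b i \<longleftrightarrow> i = n" if "a \<noteq> b" for a b
  proof (cases "a = a0")
    case False
    then have "\<forall>i. F a i \<noteq> F a0 i \<longleftrightarrow> i = n" using step[OF n two, of a] by metis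
    then show ?thesis using step[of a a0 n b] False that by blast
  qed (use step[OF n two, of b] that in blast)
  then show ?thesis by blast
qed

text \<open>The points of a coordinate line are pairwise at distance 1, so their images are too, and
  by \<open>common_direction\<close> these vary in a single coordinate \<open>\<sigma> m\<close>.
  The value \<open>s m\<close> is found by comparing the distances from \<open>s\<close> to two
  points of the line, a comparison that \<open>\<theta>\<close> preserves.\<close>

lemma isometry_coords:
  fixes \<theta> :: "('i::finite \<Rightarrow> 'a::finite) \<Rightarrow> ('i \<Rightarrow> 'a)"
  assumes iso: "\<And>s t. hamming (\<theta> s) (\<theta> t) = hamming s t" and two: "a0 \<noteq> (a1 :: 'a)"
  obtains \<sigma> h where "bij \<sigma>" "\<And>m. bij (h m)" "\<And>s m. \<theta> s (\<sigma> m) = h m (s m)"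
proof -
  \<comment> \<open>\<open>L m\<close> is the line of direction \<open>m\<close> through the
    constant point \<open>a0\<close>.\<close>
  define L where "L m a = (\<lambda>_. a0)(m := a)" for m :: 'i and a
  have LL: "L m a i \<noteq> L m b i \<longleftrightarrow> i = m" if "a \<noteq> b" for m a b i using that by (auto simp: L_def)
  have hdL: "hamming (L m a) (L m b) = 1" if "a \<noteq> b" for m a b unfolding hamming_def LL[OF that] by simp
  have "\<exists>n. \<forall>i. \<theta> (L m a) i \<noteq> \<theta> (L m b) i \<longleftrightarrow> i = n" if "a \<noteq> b" for m a b
    using hdL[OF that, of m] by (metis hamming_1E iso)
  then have "\<exists>n. \<forall>a b. a \<noteq> b \<longrightarrow> (\<forall>i. \<theta> (L m a) i \<noteq> \<theta> (L m b) i \<longleftrightarrow> i = n)" for m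
    using common_direction[OF _ two, of "\<lambda>a. \<theta> (L m a)"] by blast
  then obtain \<sigma> where \<sigma>: "\<And>m a b i. a \<noteq> b \<Longrightarrow> \<theta> (L m a) i \<noteq> \<theta> (L m b) i \<longleftrightarrow> i = \<sigma> m" by metis
  define h where "h m a = \<theta> (L m a) (\<sigma> m)" for m a
  have eq: "\<theta> s (\<sigma> m) = h m (s m)" for s m
  proof -
    obtain b where b: "s m \<noteq> b" using two by metis
    have "hamming s (L m (s m)) < hamming s (L m b)"
      unfolding hamming_less_iff[OF LL[OF b]] by (simp add: L_def)
    then have "hamming (\<theta> s) (\<theta> (L m (s m))) < hamming (\<theta> s) (\<theta> (L m b))" by (simp add: iso)
    then show ?thesis unfolding h_def using hamming_less_iff[OF \<sigma>[OF b]] by simp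
  qed
  have h: "bij (h m)" for m
    using \<sigma> by (auto simp: h_def inj_def bij_def intro!: finite_UNIV_inj_surj) metis+
  \<comment> \<open>If \<open>m\<close> and \<open>m'\<close> had the same image, then
    \<open>h m (s m) = h m' (s m')\<close> for all \<open>s\<close>; changing \<open>s\<close> at
    \<open>m\<close> alone contradicts the injectivity of \<open>h m\<close>.\<close>
  have "inj \<sigma>"
  proof
    fix m m' assume *: "\<sigma> m = \<sigma> m'"
    show "m = m'"
    proof (rule ccontr)
      assume "m \<noteq> m'"
      have "h m a0 = h m' a0" using eq[of "\<lambda>_. a0" m] eq[of "\<lambda>_. a0" m'] * by simp
      moreover have "h m a1 = h m' a0"
        using eq[of "(\<lambda>_. a0)(m := a1)" m] eq[of "(\<lambda>_. a0)(m := a1)" m'] * \<open>m \<noteq> m'\<close> by simp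
      ultimately show False using h two by (metis bij_def injD)
    qed
  qed
  then have "bij \<sigma>" by (simp add: bij_def finite_UNIV_inj_surj)
  with h eq that show ?thesis by blast
qed

section \<open>From adjacency to distance\<close>

lemma hamming_0: "hamming s t = 0 \<longleftrightarrow> s = t" by (auto simp: hamming_def)

lemma hamming_triangle: "hamming s t \<le> hamming s r + hamming r t"
proof -
  have "{i. s i \<noteq> t i} \<subseteq> {i. s i \<noteq> r i} \<union> {i. r i \<noteq> t i}" by auto
  then show ?thesis unfolding hamming_def by (meson card_Un_le card_mono finite order.trans)
qed

lemma hamming_step: assumes "hamming s t = Suc k" shows "\<exists>r. hamming s r = 1 \<and> hamming r t = k"
proof -
  obtain i where i: "s i \<noteq> t i" using assms hamming_0[of s t] by fastforce
  have "{j. s j \<noteq> (s(i := t i)) j} = {i}" using i by auto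
  moreover have "{j. (s(i := t i)) j \<noteq> t j} = {j. s j \<noteq> t j} - {i}" by auto
  ultimately show ?thesis using assms i unfolding hamming_def
    by (intro exI[of _ "s(i := t i)"]) simp
qed

text \<open>A shortest path that changes one coordinate at a time is carried to a path with as many
  steps.\<close>

lemma hamming_le_of_adj:
  assumes adj: "\<And>s t. hamming s t = 1 \<Longrightarrow> hamming (\<theta> s) (\<theta> t) = 1"
  shows "hamming (\<theta> s) (\<theta> t) \<le> hamming s t"
proof (induction "hamming s t" arbitrary: s)
  case 0
  then show ?case by (metis hamming_0 order_refl)
next
  case (Suc k)
  then obtain r where r: "hamming s r = 1" "hamming r t = k" using hamming_step by metis
  have "hamming (\<theta> s) (\<theta> t) \<le> hamming (\<theta> s) (\<theta> r) + hamming (\<theta> r) (\<theta> t)" by (rule hamming_triangle)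
  also have "\<dots> \<le> 1 + k" using adj[OF r(1)] Suc(1)[of r] r by simp
  finally show ?case using Suc by simp
qed

text \<open>The Hamming distance is the path distance of the graph of pairs at distance 1, so it
  suffices to apply \<open>hamming_le_of_adj\<close> to \<open>\<theta>\<close> and to its
  inverse.\<close>

lemma isometry_of_adj:
  fixes \<theta> :: "('i::finite \<Rightarrow> 'a) \<Rightarrow> ('i \<Rightarrow> 'a)"
  assumes "bij \<theta>" and adj: "\<And>s t. hamming (\<theta> s) (\<theta> t) = 1 \<longleftrightarrow> hamming s t = 1"
  shows "hamming (\<theta> s) (\<theta> t) = hamming s t"
proof (rule antisym)
  show "hamming (\<theta> s) (\<theta> t) \<le> hamming s t" using hamming_le_of_adj adj by blast
  have inv: "\<theta> (inv_into UNIV \<theta> s) = s" "inv_into UNIV \<theta> (\<theta> s) = s" for s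
    using assms(1) by (simp_all add: bij_def surj_f_inv_f)
  have "hamming (inv_into UNIV \<theta> (\<theta> s)) (inv_into UNIV \<theta> (\<theta> t)) \<le> hamming (\<theta> s) (\<theta> t)"
    by (rule hamming_le_of_adj) (metis adj inv(1))
  then show "hamming s t \<le> hamming (\<theta> s) (\<theta> t)" by (simp add: inv)
qed

subsection \<open>The points \<open>A l u\<close>\<close>

lemma UNIV_f3: "UNIV = {F0, F1, F2}" using f3.exhaust by auto

lemmas f3_defs = zero_f3_def one_f3_def plus_f3_def times_f3_def uminus_f3_def minus_f3_def nat_f3_def

lemma exhaust_8: "i = 1 \<or> i = 2 \<or> i = 3 \<or> i = 4 \<or> i = 5 \<or> i = 6 \<or> i = 7 \<or> i = 8" for i :: 8
proof (induct i)
  case (of_int z)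
  then have "z = 0 \<or> z = 1 \<or> z = 2 \<or> z = 3 \<or> z = 4 \<or> z = 5 \<or> z = 6 \<or> z = 7" by simp arith
  then show ?case by auto
qed

lemma e_nth: "e i $ j = (if i = j then 1 else 0)"
  by (simp add: e_def axis_def)

lemma u_nth: "u $ i = 1"
  using exhaust_8[of i] unfolding u_def by (elim disjE) (simp_all add: e_nth)

text \<open>\<open>fst_index i\<close> and \<open>snd_index i\<close> are the two arguments, in this
  order, of the \<open>zeta\<close> that occurs with \<open>l $ i\<close> in \<open>A\<close>.
  Keeping the order of \<open>zeta 7 2\<close> and \<open>zeta 5 4\<close> lets all four summands be
  treated by one formula.\<close>

definition fst_index :: "4 \<Rightarrow> 8" where
  "fst_index i = (if i = 1 then 1 else if i = 2 then 7 else if i = 3 then 3 else 5)"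

definition snd_index :: "4 \<Rightarrow> 8" where
  "snd_index i = (if i = 1 then 8 else if i = 2 then 2 else if i = 3 then 6 else 4)"

text \<open>With \<open>rot_snd\<close>: the coordinates of the powers of the map
  \<open>(a, b) |-> (b, a + b)\<close> of order 3, which is multiplication by a primitive element of
  the field of order 4.\<close>

fun rot_fst :: "f3 \<Rightarrow> bit \<Rightarrow> bit \<Rightarrow> bit" where
 "rot_fst F0 a b = a" | "rot_fst F1 a b = b" | "rot_fst F2 a b = a + b"

fun rot_snd :: "f3 \<Rightarrow> bit \<Rightarrow> bit \<Rightarrow> bit" where
 "rot_snd F0 a b = b" | "rot_snd F1 a b = a + b" | "rot_snd F2 a b = a"

lemma zeta_pow:
  assumes "p \<noteq> q"
  shows "(zeta p q ^^ f3_nat s) (component p q v) =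
    rot_fst s (v $ p) (v $ q) *s e p + rot_snd s (v $ p) (v $ q) *s e q"
  using assms by (cases s) (auto simp: component_def zeta_def vec_eq_iff e_nth eval_nat_numeral)

lemma A_nth_fst: "A l v $ fst_index i = rot_fst (l $ i) (v $ fst_index i) (v $ snd_index i)"
  using exhaust_4[of i] by (elim disjE) (simp_all add: A_def zeta_pow e_nth fst_index_def snd_index_def)

lemma A_nth_snd: "A l v $ snd_index i = rot_snd (l $ i) (v $ fst_index i) (v $ snd_index i)"
  using exhaust_4[of i] by (elim disjE) (simp_all add: A_def zeta_pow e_nth fst_index_def snd_index_def)

lemma vec8_eq_iff:
  "v = v' \<longleftrightarrow> (\<forall>i. v $ fst_index i = v' $ fst_index i \<and> v $ snd_index i = v' $ snd_index i)"
  for v v' :: V8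
proof
  assume *: "\<forall>i. v $ fst_index i = v' $ fst_index i \<and> v $ snd_index i = v' $ snd_index i"
  have "v $ j = v' $ j" for j
    using exhaust_8[of j] *[rule_format, of 1] *[rule_format, of 2] *[rule_format, of 3] *[rule_format, of 4]
    by (auto simp: fst_index_def snd_index_def)
  then show "v = v'" by (simp add: vec_eq_iff)
qed simp

lemma index_simps [simp]:
  "fst_index i = fst_index j \<longleftrightarrow> i = j" "snd_index i = snd_index j \<longleftrightarrow> i = j"
  "fst_index i \<noteq> snd_index j" "snd_index j \<noteq> fst_index i"
  using exhaust_4[of i] exhaust_4[of j] by (auto simp: fst_index_def snd_index_def)

text \<open>With \<open>A_u_nth_snd\<close>: the exponents \<open>F0\<close>, \<open>F1\<close>,
  \<open>F2\<close> give the coordinate pairs (1,1), (1,0), (0,1), so they label the three nonzero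
  vectors of each summand. \<open>point2\<close> uses the same labelling for V(2,2).\<close>

lemma A_u_nth_fst: "A l u $ fst_index i = (if l $ i = F2 then 0 else 1)"
  by (cases "l $ i") (simp_all add: A_nth_fst u_nth)

lemma A_u_nth_snd: "A l u $ snd_index i = (if l $ i = F1 then 0 else 1)"
  by (cases "l $ i") (simp_all add: A_nth_snd u_nth)

text \<open>Each \<open>zeta\<close> has order 3 on its summand, so exponents add in
  \<open>f3\<close>. Evaluation at \<open>u\<close> is enough to identify a composition of two maps
  \<open>A l\<close>, because \<open>A_u_inject\<close> recovers the exponent.\<close>

lemma A_comp_u: "A l (A m u) = A (l + m) u"
  unfolding vec8_eq_iff
proof (intro allI)
  fix i
  show "A l (A m u) $ fst_index i = A (l + m) u $ fst_index i \<and>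
      A l (A m u) $ snd_index i = A (l + m) u $ snd_index i"
    by (cases "l $ i"; cases "m $ i") (simp_all add: A_nth_fst A_nth_snd u_nth f3_defs)
qed

lemma A_u_inject: "A l u = A m u \<longleftrightarrow> l = m"
proof
  assume "A l u = A m u"
  then have "(if l $ i = F2 then 0 else 1 :: bit) = (if m $ i = F2 then 0 else 1)"
    "(if l $ i = F1 then 0 else 1 :: bit) = (if m $ i = F1 then 0 else 1)" for i
    using A_u_nth_fst A_u_nth_snd by metis+
  then have "l $ i = m $ i" for i
    by (cases "l $ i"; cases "m $ i") (metis f3.distinct zero_neq_one)+
  then show "l = m" by (simp add: vec_eq_iff)
qed simp

lemma component_nonzero:
  assumes "p \<noteq> q" "v $ p \<noteq> 0 \<or> v $ q \<noteq> 0"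
  shows "component p q v \<noteq> 0"
proof
  assume "component p q v = 0"
  then have "component p q v $ p = 0" "component p q v $ q = 0" by simp_all
  with assms show False by (simp add: component_def e_nth)
qed

lemma A_u_in_omega4: "A l u \<in> omega4"
proof -
  have nz: "A l u $ fst_index i \<noteq> 0 \<or> A l u $ snd_index i \<noteq> 0" for i
    unfolding A_u_nth_fst A_u_nth_snd by (cases "l $ i") simp_all
  show ?thesis
    using nz[of 1] nz[of 2] nz[of 3] nz[of 4] unfolding omega4_def fst_index_def snd_index_def
    by (intro CollectI conjI component_nonzero; simp; blast)
qed

text \<open>When \<open>d $ i\<close> is nonzero, the three exponents run through all of
  \<open>f3\<close>, and the three nonzero vectors of a plane over the field of order 2 sum to
  zero.\<close>

lemma A_line_sum:
  assumes "d $ i \<noteq> 0"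
  shows "A l u $ fst_index i + A (l + d) u $ fst_index i + A (l - d) u $ fst_index i = 0"
    "A l u $ snd_index i + A (l + d) u $ snd_index i + A (l - d) u $ snd_index i = 0"
  using assms by (cases "l $ i"; cases "d $ i"; simp add: A_u_nth_fst A_u_nth_snd f3_defs)+

lemma A_line_sum_eq_0:
  assumes "\<forall>i. d $ i \<noteq> 0"
  shows "A l u + A (l + d) u + A (l - d) u = 0"
  unfolding vec8_eq_iff using assms by (simp only: vector_add_component A_line_sum zero_index simp_thms)

text \<open>Equal exponents at \<open>i\<close> would cancel the \<open>i\<close>-th component of
  the sum, whereas no component of \<open>A n u\<close> vanishes.\<close>

lemma A_u_add_imp_nth_neq:
  assumes "A l u + A m u = A n u"
  shows "l $ i \<noteq> m $ i"
proof
  assume "l $ i = m $ i"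
  with arg_cong[OF assms, of "\<lambda>v. (v $ fst_index i, v $ snd_index i)"] show False
    by (simp add: A_u_nth_fst A_u_nth_snd split: if_splits)
qed

section \<open>Labelling the points of V(2,2) by \<open>f3\<close>, and multilinear
  extension\<close>

definition point2 :: "f3 \<Rightarrow> V2" where
  "point2 s = (\<chi> i. if i = 1 then (if s = F2 then 0 else 1) else (if s = F1 then 0 else 1))"

lemma point2_nth: "point2 s $ 1 = (if s = F2 then 0 else 1)" "point2 s $ 2 = (if s = F1 then 0 else 1)"
  by (simp_all add: point2_def)

lemma point2_inject: "point2 s = point2 t \<longleftrightarrow> s = t"
  by (cases s; cases t; simp add: vec_eq_iff forall_2 point2_nth)

lemma point2_nonzero: "point2 s \<noteq> 0"
  by (cases s; simp add: vec_eq_iff forall_2 point2_nth)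

lemma ex_point2: "x \<noteq> 0 \<Longrightarrow> \<exists>s. x = point2 s"
proof -
  assume "x \<noteq> 0"
  then have "x = point2 F0 \<or> x = point2 F1 \<or> x = point2 F2"
    by (auto simp: vec_eq_iff forall_2 point2_nth)
  then show ?thesis by blast
qed

lemma nonzero_iff_point2: "x \<noteq> 0 \<longleftrightarrow> (\<exists>s. x = point2 s)"
  using point2_nonzero ex_point2 by metis

definition pure_tensor :: "(3 \<Rightarrow> f3) \<Rightarrow> V2_cubed" where
  "pure_tensor t = tensor3 (point2 (t 1)) (point2 (t 2)) (point2 (t 3))"

text \<open>\<open>point2 (base2 i)\<close> is the \<open>i\<close>-th unit vector.\<close>

definition base2 :: "2 \<Rightarrow> f3" where "base2 i = (if i = 1 then F1 else F2)"

text \<open>This interpolates \<open>q\<close> from its values at the eight triples of unit vectors,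
  so it is linear for every \<open>q\<close>; agreement with \<open>q\<close> on all pure tensors is
  a separate condition.\<close>

definition multilin :: "(f3 \<Rightarrow> f3 \<Rightarrow> f3 \<Rightarrow> V8) \<Rightarrow> V2_cubed \<Rightarrow> V8" where
  "multilin q p = (\<Sum>i\<in>UNIV. \<Sum>j\<in>UNIV. \<Sum>k\<in>UNIV. p $ (i, j, k) *s q (base2 i) (base2 j) (base2 k))"

lemma linear_multilin: "Vector_Spaces.linear (*s) (*s) (multilin q)"
  unfolding linear_iff_module_hom module_hom_iff
  by (intro conjI allI vec.module_axioms)
    (simp_all only: multilin_def vector_add_component vec.scale_left_distrib sum.distrib
      vector_smult_component vec.scale_sum_right vec.scale_scale)

lemma V8_sum_eq_0: "x = y + z" if "x + y + z = 0" for x y z :: V8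
proof -
  have bit: "a + b + c = 0 \<Longrightarrow> a = b + c" for a b c :: bit
    by (cases a; cases b; cases c) simp_all
  have "x $ i = (y + z) $ i" for i
    using bit[of "x $ i" "y $ i" "z $ i"] arg_cong[OF that, of "\<lambda>v. v $ i"]
    by (simp only: vector_add_component zero_index)
  then show ?thesis by (simp add: vec_eq_iff)
qed

text \<open>The hypothesis says that \<open>g\<close> respects the one linear relation among the
  nonzero vectors of V(2,2), so \<open>g\<close> is the restriction of a linear map.\<close>

lemma sum_point2:
  fixes g :: "f3 \<Rightarrow> V8"
  assumes "g F0 + g F1 + g F2 = 0"
  shows "(\<Sum>i\<in>UNIV. point2 s $ i *s g (base2 i)) = g s"
proof -
  have "g F0 = g F1 + g F2" using assms by (rule V8_sum_eq_0)
  then show ?thesis by (cases s) (simp_all add: sum_2 point2_nth base2_def)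
qed

text \<open>\<open>sum_point2\<close> collapses the triple sum one argument at a time, starting with
  the innermost.\<close>

lemma multilin_pure_tensor:
  assumes "\<And>b c. q F0 b c + q F1 b c + q F2 b c = 0" "\<And>a c. q a F0 c + q a F1 c + q a F2 c = 0"
    "\<And>a b. q a b F0 + q a b F1 + q a b F2 = 0"
  shows "multilin q (pure_tensor t) = q (t 1) (t 2) (t 3)"
proof -
  have 1: "(\<Sum>k\<in>UNIV. point2 (t 3) $ k *s q a b (base2 k)) = q a b (t 3)" for a b
    by (rule sum_point2[of "q a b"]) (rule assms)
  have 2: "(\<Sum>j\<in>UNIV. point2 (t 2) $ j *s q a (base2 j) (t 3)) = q a (t 2) (t 3)" for a
    by (rule sum_point2[of "\<lambda>b. q a b (t 3)"]) (rule assms)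
  have 3: "(\<Sum>i\<in>UNIV. point2 (t 1) $ i *s q (base2 i) (t 2) (t 3)) = q (t 1) (t 2) (t 3)"
    by (rule sum_point2[of "\<lambda>a. q a (t 2) (t 3)"]) (rule assms)
  have "multilin q (pure_tensor t) =
      (\<Sum>i\<in>UNIV. point2 (t 1) $ i *s (\<Sum>j\<in>UNIV. point2 (t 2) $ j *s
      (\<Sum>k\<in>UNIV. point2 (t 3) $ k *s q (base2 i) (base2 j) (base2 k))))"
    by (simp only: multilin_def pure_tensor_def tensor3_def vec.scale_sum_right
        vec.scale_scale vec_lambda_beta prod.case mult.assoc)
  also have "\<dots> = q (t 1) (t 2) (t 3)"
    by (simp only: 1 2 3)
  finally show ?thesis .
qed

subsection \<open>The Segre variety of an affine hyperplane\<close>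

definition dot4 :: "f3 ^ 4 \<Rightarrow> f3 ^ 4 \<Rightarrow> f3" where "dot4 f l = (\<Sum>i\<in>UNIV. f $ i * l $ i)"

lemma dot4_add: "dot4 f (l + m) = dot4 f l + dot4 f m"
  by (simp add: dot4_def sum.distrib distrib_left)

lemma dot4_diff: "dot4 f (l - m) = dot4 f l - dot4 f m"
  by (simp add: dot4_def sum_subtractf right_diff_distrib)

lemma dot4_scale: "dot4 f (a *s l) = a * dot4 f l"
  by (simp add: dot4_def sum_distrib_left mult.left_commute)

lemma f3_square: "x * x = 1" if "x \<noteq> 0" for x :: f3
  using that by (cases x) (simp_all add: f3_defs)

lemma f3_three: "x + x + x = 0" for x :: f3
  by (cases x) (simp_all add: f3_defs)

text \<open>
  The vectors of the kernel of \<open>f\<close> without a zero coordinate are exactly the nonzero multiples of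
  these three; they are the directions of the generators.
\<close>

definition direction :: "f3 ^ 4 \<Rightarrow> 3 \<Rightarrow> f3 ^ 4" where
  "direction f m = (\<chi> i. if i = 1 \<or> i = (if m = 1 then 2 else if m = 2 then 3 else 4) then f $ i else - f $ i)"

definition affine_point :: "f3 ^ 4 \<Rightarrow> f3 ^ 4 \<Rightarrow> (3 \<Rightarrow> f3) \<Rightarrow> f3 ^ 4" where
  "affine_point f c t = c + (\<Sum>m\<in>UNIV. t m *s direction f m)"

text \<open>Every direction has two plus and two minus signs in front of the entries of
  \<open>f\<close>, and each entry of \<open>f\<close> has square 1.\<close>

lemma dot4_direction: assumes "\<forall>i. f $ i \<noteq> 0" shows "dot4 f (direction f m) = 0"
  using assms exhaust_3[of m] by (elim disjE) (simp_all add: dot4_def sum_4 direction_def f3_square f3_three)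

lemma dot4_affine_point:  assumes "\<forall>i. f $ i \<noteq> 0" shows "dot4 f (affine_point f c t) = dot4 f c"
  using dot4_direction[OF assms] by (simp add: affine_point_def sum_3 dot4_add dot4_scale)

lemma direction_nonzero: "f $ i \<noteq> 0 \<Longrightarrow> direction f m $ i \<noteq> 0"
  by (simp add: direction_def)

lemma ex_affine_point:
  assumes f: "\<forall>i. f $ i \<noteq> 0" and l: "dot4 f l = dot4 f c"
  shows "\<exists>t. l = affine_point f c t"
proof -
  define n where "n = l - c"
  have n: "f $ 1 * n $ 1 + f $ 2 * n $ 2 + f $ 3 * n $ 3 + f $ 4 * n $ 4 = 0"
    using l dot4_diff[of f l c] by (simp add: n_def dot4_def sum_4)
  \<comment> \<open>If \<open>n\<close> is the wanted combination, then \<open>f $ 1 * n $ 1\<close>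
    is \<open>t 1 + t 2 + t 3\<close> and \<open>f $ 2 * n $ 2\<close> is
    \<open>t 1 - t 2 - t 3\<close>. Their sum is twice, that is minus, \<open>t 1\<close>; the other
    two coefficients arise in the same way.\<close>
  define t where "t m = - (f $ 1 * n $ 1 + f $ (if m = 1 then 2 else if m = 2 then 3 else 4)
    * n $ (if m = 1 then 2 else if m = 2 then 3 else 4))" for m :: 3
  have alg: "a = x * p + y * p + z * p \<and> b = x * q + y * - q + z * - q \<and>
      c = x * - r + y * r + z * - r \<and> d = x * - s + y * - s + z * s"
    if *: "p * a + q * b + r * c + s * d = 0" and sq: "p * p = 1" "q * q = 1" "r * r = 1" "s * s = 1"
      and xyz: "x = - (p * a + q * b)" "y = - (p * a + r * c)" "z = - (p * a + s * d)"
    for a b c d p q r s x y z :: f3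
  proof -
    \<comment> \<open>The entries of \<open>f\<close> are their own inverses, so multiplying by them
      leaves a sign identity in four elements of \<open>f3\<close> with sum zero.\<close>
    define A B C D where D: "A = p * a" "B = q * b" "C = r * c" "D = s * d"
    have eqs: "a = A * p" "b = B * q" "c = C * r" "d = D * s"
      unfolding D using sq by (simp_all add: mult.assoc mult.commute mult.left_commute)
    have "A + B + C + D = 0" using * D by simp
    then have e: "A = x + y + z" "B = x - y - z" "C = - x + y - z" "D = - x - y + z"
      unfolding xyz D[symmetric] by (cases A; cases B; cases C; cases D; simp add: f3_defs)+
    show ?thesis unfolding eqs e by (simp add: algebra_simps)
  qed
  have t: "t 1 = - (f $ 1 * n $ 1 + f $ 2 * n $ 2)" "t 2 = - (f $ 1 * n $ 1 + f $ 3 * n $ 3)"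
    "t 3 = - (f $ 1 * n $ 1 + f $ 4 * n $ 4)"
    by (simp_all add: t_def)
  have "n = (\<Sum>m\<in>UNIV. t m *s direction f m)"
    using alg[OF n _ _ _ _ t] f3_square f unfolding vec_eq_iff forall_4 sum_3 by (simp add: direction_def)
  then show ?thesis unfolding affine_point_def n_def by (metis add.commute diff_add_cancel)
qed

lemma affine_point_nth: "affine_point f c t $ i = c $ i + (\<Sum>m\<in>UNIV. t m * direction f m $ i)"
  by (simp add: affine_point_def)

lemma hamming_1I:
  assumes "\<And>i. s i \<noteq> t i \<longleftrightarrow> i = n" shows "hamming s t = 1"
  unfolding hamming_def assms by simp

text \<open>Of all combinations of the three directions, only the nonzero multiples of a single
  direction have no zero coordinate. Dividing out the entries of \<open>f\<close> leaves four signed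
  sums of the coefficients, and the 27 cases are checked.\<close>

lemma hamming_affine_point:
  assumes f: "\<forall>i. f $ i \<noteq> 0" and ne: "\<forall>i. affine_point f c s $ i \<noteq> affine_point f c t $ i"
  shows "hamming s t = 1"
proof -
  define x where "x m = s m - t m" for m
  have "(\<Sum>m\<in>UNIV. x m * direction f m $ i) \<noteq> 0" for i
    using ne[rule_format, of i] unfolding affine_point_nth x_def by (simp add: left_diff_distrib sum_subtractf)
  from this[of 1] this[of 2] this[of 3] this[of 4]
  have "x 1 * f $ 1 + x 2 * f $ 1 + x 3 * f $ 1 \<noteq> 0" "x 1 * f $ 2 - x 2 * f $ 2 - x 3 * f $ 2 \<noteq> 0"
    "- (x 1 * f $ 3) + x 2 * f $ 3 - x 3 * f $ 3 \<noteq> 0" "- (x 1 * f $ 4) - x 2 * f $ 4 + x 3 * f $ 4 \<noteq> 0"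
    by (simp_all add: sum_3 direction_def)
  then have "x 1 + x 2 + x 3 \<noteq> 0" "x 1 - x 2 - x 3 \<noteq> 0" "- x 1 + x 2 - x 3 \<noteq> 0" "- x 1 - x 2 + x 3 \<noteq> 0"
    by (metis (no_types, lifting) mult_minus_left distrib_right left_diff_distrib mult_zero_left)+
  then have "(x 1 \<noteq> 0 \<and> x 2 = 0 \<and> x 3 = 0) \<or> (x 1 = 0 \<and> x 2 \<noteq> 0 \<and> x 3 = 0) \<or> (x 1 = 0 \<and> x 2 = 0 \<and> x 3 \<noteq> 0)"
    by (cases "x 1"; cases "x 2"; cases "x 3"; simp add: f3_defs)
  then have "\<exists>n. \<forall>i. s i \<noteq> t i \<longleftrightarrow> i = n"
    unfolding x_def forall_3 by auto
  then show ?thesis using hamming_1I by metis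
qed

lemma f3_arith: "x + F0 * y = x" "x + F1 * y = x + y" "x + F2 * y = x - y"
  by (cases x; cases y; simp add: f3_defs)+

lemma A_line_sum_scale:
  assumes "\<forall>i. d $ i \<noteq> 0"
  shows "A (l + F0 *s d) u + A (l + F1 *s d) u + A (l + F2 *s d) u = 0"
proof -
  have "l + F0 *s d = l" "l + F1 *s d = l + d" "l + F2 *s d = l - d"
    unfolding vec_eq_iff vector_add_component vector_minus_component vector_smult_component
    by (intro allI; metis f3_arith)+
  then show ?thesis using A_line_sum_eq_0[OF assms, of l] by (simp only:)
qed

definition segre_map :: "f3 ^ 4 \<Rightarrow> f3 ^ 4 \<Rightarrow> V2_cubed \<Rightarrow> V8" where
  "segre_map f c = multilin (\<lambda>x y z. A (c + x *s direction f 1 + y *s direction f 2 + z *s direction f 3) u)"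

text \<open>Varying one coordinate moves the exponent along a line whose direction has no zero
  entry, so the zero sums required by \<open>multilin_pure_tensor\<close> are line sums.\<close>

lemma segre_map_pure_tensor:
  assumes f: "\<forall>i. f $ i \<noteq> 0"
  shows "segre_map f c (pure_tensor t) = A (affine_point f c t) u"
proof -
  have d: "\<forall>i. direction f m $ i \<noteq> 0" for m using f direction_nonzero by blast
  have 1: "A (c + F0 *s direction f 1 + y *s direction f 2 + z *s direction f 3) u
    + A (c + F1 *s direction f 1 + y *s direction f 2 + z *s direction f 3) u
    + A (c + F2 *s direction f 1 + y *s direction f 2 + z *s direction f 3) u = 0" for y z
    using A_line_sum_scale[OF d, of "c + y *s direction f 2 + z *s direction f 3" 1] by (simp add: ac_simps)
  have 2: "A (c + x *s direction f 1 + F0 *s direction f 2 + z *s direction f 3) u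
    + A (c + x *s direction f 1 + F1 *s direction f 2 + z *s direction f 3) u
    + A (c + x *s direction f 1 + F2 *s direction f 2 + z *s direction f 3) u = 0" for x z
    using A_line_sum_scale[OF d, of "c + x *s direction f 1 + z *s direction f 3" 2] by (simp add: ac_simps)
  show ?thesis unfolding segre_map_def
    by (subst multilin_pure_tensor[OF 1 2 A_line_sum_scale[OF d]]) (simp add: affine_point_def sum_3 add.assoc)
qed

lemma linear_segre_map: "Vector_Spaces.linear (*s) (*s) (segre_map f c)"
  unfolding segre_map_def by (rule linear_multilin)

text \<open>The three terms agree at these two indices, and \<open>x + x + x = x\<close> in
  characteristic 2.\<close>

lemma A_line_sum_fixed:
  "n $ i = 0 \<Longrightarrow> (A l u + A (l + n) u + A (l - n) u) $ fst_index i = A l u $ fst_index i"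
  "n $ i = 0 \<Longrightarrow> (A l u + A (l + n) u + A (l - n) u) $ snd_index i = A l u $ snd_index i"
  by (simp_all add: A_u_nth_fst A_u_nth_snd)

lemma A_line_sum_moving:
  "n $ i \<noteq> 0 \<Longrightarrow> (A l u + A (l + n) u + A (l - n) u) $ fst_index i = 0"
  "n $ i \<noteq> 0 \<Longrightarrow> (A l u + A (l + n) u + A (l - n) u) $ snd_index i = 0"
  unfolding vector_add_component by (rule A_line_sum, assumption)+

text \<open>The points of one coset span \<open>V8\<close>. A line sum in a direction supported on
  two coordinates kills the two corresponding summands; adding two such sums cancels a third summand
  and leaves a basis vector of the last.\<close>

lemma subspace_with_coset_eq_UNIV:
  assumes f: "\<forall>i. f $ i \<noteq> 0" and U: "vec.subspace U" and A: "\<And>l. dot4 f l = k \<Longrightarrow> A l u \<in> U"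
  shows "U = UNIV"
proof -
  have e: "e (fst_index a) \<in> U \<and> e (snd_index a) \<in> U"
    if un: "UNIV = {a, b, c, d}" and dist: "distinct [a, b, c, d]"
    for a b c d :: 4
  proof -
    have ne: "a \<noteq> b" "b \<noteq> a" "a \<noteq> c" "c \<noteq> a" "a \<noteq> d" "d \<noteq> a"
      "b \<noteq> c" "c \<noteq> b" "b \<noteq> d" "d \<noteq> b" "c \<noteq> d" "d \<noteq> c"
      using dist by auto
    \<comment> \<open>Summing over a line with direction \<open>n\<close> leaves only the components with index \<open>a\<close> and \<open>b\<close>.\<close>
    define n where "n = (\<chi> i. if i = c then f $ c else if i = d then - f $ d else 0)"
    \<comment> \<open>The exponent is \<open>s\<close> at \<open>a\<close> and 0 at \<open>b\<close>
      and \<open>d\<close>; the entry at \<open>c\<close> is solved for so that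
      \<open>dot4 f (m s)\<close> is \<open>k\<close>.\<close>
    define m where "m s = (\<chi> i. if i = a then s else if i = c then f $ c * (k - f $ a * s) else 0)" for s
    define T where "T s = A (m s) u + A (m s + n) u + A (m s - n) u" for s
    have sum: "(\<Sum>i\<in>UNIV. g i) = g a + (g b + (g c + g d))" for g :: "4 \<Rightarrow> f3"
      unfolding un using ne by simp
    have n: "n $ a = 0" "n $ b = 0" "n $ c \<noteq> 0" "n $ d \<noteq> 0" using ne f by (auto simp: n_def)
    have m: "m s $ a = s" "m s $ b = F0" for s using ne by (auto simp: m_def zero_f3_def)
    have "dot4 f n = 0" using ne f f3_square by (simp add: dot4_def sum n_def)
    moreover have "dot4 f (m s) = k" for s
    proof -
      have "f $ c * (f $ c * (k - f $ a * s)) = k - f $ a * s"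
        using f f3_square[of "f $ c"] by (metis mult.assoc mult_1)
      then have "f $ a * s + f $ c * (f $ c * (k - f $ a * s)) = k" by (metis add.commute diff_add_cancel)
      moreover have "dot4 f (m s) = f $ a * s + f $ c * (f $ c * (k - f $ a * s))"
        using ne by (simp add: dot4_def sum m_def)
      ultimately show ?thesis by metis
    qed
    ultimately have TU: "T s \<in> U" for s
      unfolding T_def by (intro vec.subspace_add[OF U] A) (simp_all add: dot4_add dot4_diff)
    have T: "T s $ fst_index a = A (m s) u $ fst_index a" "T s $ snd_index a = A (m s) u $ snd_index a"
      "T s $ fst_index b = A (m s) u $ fst_index b" "T s $ snd_index b = A (m s) u $ snd_index b"
      "T s $ fst_index c = 0" "T s $ snd_index c = 0" "T s $ fst_index d = 0" "T s $ snd_index d = 0" for s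
      unfolding T_def using n by (simp_all only: A_line_sum_fixed A_line_sum_moving simp_thms)
    have all: "(\<forall>i. P i) \<longleftrightarrow> P a \<and> P b \<and> P c \<and> P d" for P :: "4 \<Rightarrow> bool"
      using un by (metis UNIV_I empty_iff insert_iff)
    \<comment> \<open>At \<open>a\<close> these sums are (1,1) + (0,1) and (1,1) + (1,0); at
      \<open>b\<close> the two terms are equal and cancel.\<close>
    have "e (fst_index a) = T F0 + T F2" "e (snd_index a) = T F0 + T F1"
      unfolding vec8_eq_iff all vector_add_component T A_u_nth_fst A_u_nth_snd m
      using ne by (simp_all add: e_nth)
    then show ?thesis using TU vec.subspace_add[OF U] by metis
  qed
  have U4: "UNIV = {1, 2, 3, 4 :: 4}" "UNIV = {2, 1, 3, 4 :: 4}" "UNIV = {3, 1, 2, 4 :: 4}" "UNIV = {4, 1, 2, 3 :: 4}"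
    using UNIV_4 by auto
  have e1: "e (fst_index 1) \<in> U \<and> e (snd_index 1) \<in> U" by (rule e[OF U4(1)]) simp
  have e2: "e (fst_index 2) \<in> U \<and> e (snd_index 2) \<in> U" by (rule e[OF U4(2)]) simp
  have e3: "e (fst_index 3) \<in> U \<and> e (snd_index 3) \<in> U" by (rule e[OF U4(3)]) simp
  have e4: "e (fst_index 4) \<in> U \<and> e (snd_index 4) \<in> U" by (rule e[OF U4(4)]) simp
  have e: "e (fst_index a) \<in> U" "e (snd_index a) \<in> U" for a
    using exhaust_4[of a] e1 e2 e3 e4 by metis+
  have "v \<in> U" for v :: V8
  proof -
    have "v = (\<Sum>i\<in>UNIV. v $ fst_index i *s e (fst_index i) + v $ snd_index i *s e (snd_index i))"
      unfolding vec8_eq_iff forall_4 sum_4 by (simp add: e_nth)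
    also have "\<dots> \<in> U"
      by (intro vec.subspace_sum[OF U] vec.subspace_add[OF U] vec.subspace_scale[OF U] e)
    finally show ?thesis .
  qed
  then show ?thesis by blast
qed

text \<open>The image is a subspace containing the points of a whole coset, so the map is onto; both
  spaces have dimension 8, so it is also injective.\<close>

lemma bij_segre_map:
  assumes f: "\<forall>i. f $ i \<noteq> 0"
  shows "bij (segre_map f c)"
proof -
  interpret P: Vector_Spaces.linear "(*s)" "(*s)" "segre_map f c" by (rule linear_segre_map)
  have "vec.subspace (range (segre_map f c))"
    using P.subspace_image[OF vec.subspace_UNIV] .
  moreover have "A l u \<in> range (segre_map f c)" if "dot4 f l = dot4 f c" for l
    using ex_affine_point[OF f that] segre_map_pure_tensor[OF f, of c] by (metis rangeI)
  ultimately have surj: "surj (segre_map f c)"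
    using subspace_with_coset_eq_UNIV[OF f] by blast
  have "inj (segre_map f c)"
    by (rule vec.linear_surjective_imp_injective[OF linear_segre_map surj]) (unfold vec_dim_card, simp)
  with surj show ?thesis by (simp add: bij_def)
qed

lemma ex_triple: "\<exists>t :: 3 \<Rightarrow> 'a. t 1 = x \<and> t 2 = y \<and> t 3 = z"
  by (intro exI[of _ "\<lambda>m. if m = 1 then x else if m = 2 then y else z"]) simp

lemma segre_image_eq: "segre_image \<phi> = range (\<lambda>t. \<phi> (pure_tensor t))"
proof (intro equalityI subsetI)
  fix v assume "v \<in> segre_image \<phi>"
  then obtain x y z where v: "v = \<phi> (tensor3 (point2 x) (point2 y) (point2 z))"
    unfolding segre_image_def nonzero_iff_point2 by blast
  moreover obtain t :: "3 \<Rightarrow> f3" where "t 1 = x \<and> t 2 = y \<and> t 3 = z" using ex_triple by metis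
  ultimately have "v = \<phi> (pure_tensor t)" by (simp add: pure_tensor_def)
  then show "v \<in> range (\<lambda>t. \<phi> (pure_tensor t))" by blast
next
  fix v assume "v \<in> range (\<lambda>t. \<phi> (pure_tensor t))"
  then show "v \<in> segre_image \<phi>" unfolding segre_image_def pure_tensor_def using point2_nonzero by blast
qed

lemma segre_param_segre_map:
  assumes f: "\<forall>i. f $ i \<noteq> 0"
  shows "segre_param (segre_map f c) {A l u | l. dot4 f l = dot4 f c}"
proof -
  have "{A l u | l. dot4 f l = dot4 f c} = range (\<lambda>t. A (affine_point f c t) u)"
    using ex_affine_point[OF f, of _ c] dot4_affine_point[OF f, of c] by blast
  then show ?thesis
    unfolding segre_param_def segre_image_eq segre_map_pure_tensor[OF f]
    using linear_segre_map bij_segre_map[OF f] by blast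
qed

lemma affine_point_inject:
  assumes f: "\<forall>i. f $ i \<noteq> 0"
  shows "affine_point f c s = affine_point f c t \<longleftrightarrow> s = t"
proof
  assume eq: "affine_point f c s = affine_point f c t"
  define x where "x m = s m - t m" for m
  have "(\<Sum>m\<in>UNIV. x m * direction f m $ i) = 0" for i
    using arg_cong[OF eq, of "\<lambda>v. v $ i"] unfolding affine_point_nth x_def by (simp add: left_diff_distrib sum_subtractf)
  from this[of 1] this[of 2] this[of 3]
  have "(x 1 + x 2 + x 3) * f $ 1 = 0" "(x 1 - x 2 - x 3) * f $ 2 = 0" "(- x 1 + x 2 - x 3) * f $ 3 = 0"
    by (simp_all add: sum_3 direction_def algebra_simps)
  then have "x 1 + x 2 + x 3 = 0" "x 1 - x 2 - x 3 = 0" "- x 1 + x 2 - x 3 = 0"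
    using f by simp_all
  then have "x 1 = 0 \<and> x 2 = 0 \<and> x 3 = 0"
    by (cases "x 1"; cases "x 2"; cases "x 3"; simp add: f3_defs)
  then have "\<forall>m. s m = t m" unfolding forall_3 x_def by simp
  then show "s = t" by blast
qed simp

section \<open>Recovering the coordinates from the point set\<close>

lemma pure_tensor_inject: "pure_tensor s = pure_tensor t \<longleftrightarrow> s = t"
proof
  \<comment> \<open>The segre map of the all-one functional turns equal tensors into equal points,
    for which injectivity is known.\<close>
  let ?f = "1 :: f3 ^ 4"
  assume "pure_tensor s = pure_tensor t"
  then have "A (affine_point ?f 0 s) u = A (affine_point ?f 0 t) u"
    using segre_map_pure_tensor[of ?f 0] by (metis one_index zero_neq_one)
  then show "s = t" by (simp add: A_u_inject affine_point_inject)
qed simp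

text \<open>
  Transported through a segre map, a sum of two pure tensors can only be pure if the difference
  of the two exponents has no zero coordinate.
\<close>

lemma pure_tensor_add_iff: "(\<exists>r. pure_tensor s + pure_tensor t = pure_tensor r) \<longleftrightarrow> hamming s t = 1"
proof -
  let ?f = "1 :: f3 ^ 4"
  have f: "\<forall>i. ?f $ i \<noteq> 0" by simp
  interpret P: Vector_Spaces.linear "(*s)" "(*s)" "segre_map ?f 0" by (rule linear_segre_map)
  have "pure_tensor s + pure_tensor t = pure_tensor r \<longleftrightarrow>
      segre_map ?f 0 (pure_tensor s + pure_tensor t) = segre_map ?f 0 (pure_tensor r)" for r
    using bij_segre_map[OF f] by (metis bij_pointE)
  then have eq: "pure_tensor s + pure_tensor t = pure_tensor r \<longleftrightarrow>
      A (affine_point ?f 0 s) u + A (affine_point ?f 0 t) u = A (affine_point ?f 0 r) u"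
      for r
    by (simp only: P.add segre_map_pure_tensor[OF f])
  show ?thesis
  proof
    assume "\<exists>r. pure_tensor s + pure_tensor t = pure_tensor r"
    then show "hamming s t = 1" unfolding eq using A_u_add_imp_nth_neq hamming_affine_point[OF f] by metis
  next
    assume "hamming s t = 1"
    then obtain n where n: "\<And>i. s i \<noteq> t i \<longleftrightarrow> i = n" using hamming_1E by blast
    have n': "t i = s i" if "i \<noteq> n" for i using n that by metis
    \<comment> \<open>\<open>s\<close>, \<open>t\<close> and \<open>r\<close> are the three triples
      on a line of direction \<open>n\<close>: the exponents of \<open>t\<close> and
      \<open>r\<close> differ from that of \<open>s\<close> by \<open>d\<close> and
      \<open>-d\<close>.\<close>
    define d where "d = (t n - s n) *s direction ?f n"
    have d: "\<forall>i. d $ i \<noteq> 0" unfolding d_def using n[of n] direction_nonzero[of ?f] by simp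
    define r where "r = s(n := s n - (t n - s n))"
    have "(\<Sum>m\<in>UNIV. t m * direction ?f m $ i) =
        (\<Sum>m\<in>UNIV. s m * direction ?f m $ i + (if m = n then d $ i else 0))"
      "(\<Sum>m\<in>UNIV. r m * direction ?f m $ i) =
        (\<Sum>m\<in>UNIV. s m * direction ?f m $ i - (if m = n then d $ i else 0))" for i
      by (auto intro!: sum.cong simp: d_def r_def n' algebra_simps)
    then have "affine_point ?f 0 t = affine_point ?f 0 s + d" "affine_point ?f 0 r = affine_point ?f 0 s - d"
      unfolding vec_eq_iff by (simp_all add: affine_point_nth sum.distrib sum_subtractf)
    then have "A (affine_point ?f 0 r) u + A (affine_point ?f 0 s) u + A (affine_point ?f 0 t) u = 0"
      using A_line_sum_eq_0[OF d, of "affine_point ?f 0 s"] by (simp add: ac_simps)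
    then have "A (affine_point ?f 0 s) u + A (affine_point ?f 0 t) u = A (affine_point ?f 0 r) u"
      using V8_sum_eq_0 by metis
    then show "\<exists>r. pure_tensor s + pure_tensor t = pure_tensor r" using eq by blast
  qed
qed

lemma finite_UNIV_f3: "finite (UNIV :: f3 set)" unfolding UNIV_f3 by simp
instance f3 :: finite by standard (rule finite_UNIV_f3)

lemma card_UNIV_f3: "CARD(f3) = 3" unfolding UNIV_f3 by simp

text \<open>The left side depends only on two points and on \<open>S\<close>, so any two
  parametrisations of \<open>S\<close> agree on which points are adjacent.\<close>

lemma segre_param_adj:
  assumes "segre_param \<phi> S"
  shows "\<phi> (pure_tensor s) + \<phi> (pure_tensor t) \<in> S \<longleftrightarrow> hamming s t = 1"
proof -
  interpret P: Vector_Spaces.linear "(*s)" "(*s)" \<phi> using assms by (simp add: segre_param_def)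
  have "inj \<phi>" and S: "S = range (\<lambda>t. \<phi> (pure_tensor t))"
    using assms by (auto simp: segre_param_def segre_image_eq bij_def)
  have "\<phi> (pure_tensor s) + \<phi> (pure_tensor t) \<in> S \<longleftrightarrow> (\<exists>r. \<phi> (pure_tensor s + pure_tensor t) = \<phi> (pure_tensor r))"
    unfolding S P.add by blast
  also have "\<dots> \<longleftrightarrow> (\<exists>r. pure_tensor s + pure_tensor t = pure_tensor r)" using \<open>inj \<phi>\<close> by (simp add: inj_eq)
  finally show ?thesis by (simp only: pure_tensor_add_iff)
qed

text \<open>The change of coordinates \<open>\<theta>\<close> is a bijection that respects adjacency
  by \<open>segre_param_adj\<close>, hence an isometry, and \<open>isometry_coords\<close> gives its
  form.\<close>

lemma segre_param_transfer:
  assumes \<phi>: "segre_param \<phi> S" and \<psi>: "segre_param \<psi> S"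
  obtains \<tau> \<eta> where "bij \<tau>" "\<And>n. bij (\<eta> n)" "\<And>s. \<psi> (pure_tensor s) = \<phi> (pure_tensor (\<lambda>n. \<eta> n (s (\<tau> n))))"
proof -
  have "range (\<lambda>t. \<phi> (pure_tensor t)) = range (\<lambda>t. \<psi> (pure_tensor t))"
    using assms by (simp add: segre_param_def segre_image_eq)
  then have "\<forall>s. \<exists>t. \<psi> (pure_tensor s) = \<phi> (pure_tensor t)" "\<forall>s. \<exists>t. \<phi> (pure_tensor s) = \<psi> (pure_tensor t)"
    by blast+
  then obtain \<theta> where \<theta>: "\<And>s. \<psi> (pure_tensor s) = \<phi> (pure_tensor (\<theta> s))" by metis
  have inj: "\<phi> (pure_tensor s) = \<phi> (pure_tensor t) \<longleftrightarrow> s = t" "\<psi> (pure_tensor s) = \<psi> (pure_tensor t) \<longleftrightarrow> s = t" for s t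
    using assms by (simp_all add: segre_param_def bij_def inj_eq pure_tensor_inject)
  have "inj \<theta>" by (rule injI, drule arg_cong[of _ _ "\<lambda>t. \<phi> (pure_tensor t)"]) (simp add: inj flip: \<theta>)
  moreover have "surj \<theta>"
    using \<open>\<forall>s. \<exists>t. \<phi> (pure_tensor s) = \<psi> (pure_tensor t)\<close> unfolding surj_def \<theta> inj(1) .
  ultimately have "bij \<theta>" by (simp add: bij_def)
  have "hamming (\<theta> s) (\<theta> t) = 1 \<longleftrightarrow> hamming s t = 1" for s t
    using segre_param_adj[OF \<phi>, of "\<theta> s" "\<theta> t"] segre_param_adj[OF \<psi>, of s t] by (simp only: \<theta>)
  then have "hamming (\<theta> s) (\<theta> t) = hamming s t" for s t
    using isometry_of_adj[OF \<open>bij \<theta>\<close>] by blast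
  then obtain \<sigma> h where \<sigma>: "bij \<sigma>" and h: "\<And>m. bij (h m)" and eq: "\<And>s m. \<theta> s (\<sigma> m) = h m (s m)"
    by (rule isometry_coords[OF _ f3.distinct(1)]) (rule that)
  \<comment> \<open>\<open>\<sigma>\<close> sends a source coordinate to its place in the target;
    the conclusion is indexed by target coordinates, hence the inverse.\<close>
  define \<tau> where "\<tau> = inv_into UNIV \<sigma>"
  have "\<sigma> (\<tau> n) = n" for n using \<sigma> by (simp add: \<tau>_def bij_def surj_f_inv_f)
  then have "\<theta> s = (\<lambda>n. h (\<tau> n) (s (\<tau> n)))" for s using eq[of s "\<tau> _"] by (intro ext) simp
  moreover have "bij \<tau>" using \<sigma> by (simp add: \<tau>_def bij_imp_bij_inv)
  ultimately show ?thesis using that[of \<tau> "\<lambda>n. h (\<tau> n)"] h \<theta> by simp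
qed

lemma Collect_pure_tensor:
  "{\<phi> (pure_tensor t) | t. P (t 1) (t 2) (t 3)} =
    {\<phi> (tensor3 (point2 a) (point2 b) (point2 c)) | a b c. P a b c}"
proof (intro equalityI subsetI)
  fix v assume "v \<in> {\<phi> (tensor3 (point2 a) (point2 b) (point2 c)) | a b c. P a b c}"
  then obtain a b c where v: "v = \<phi> (tensor3 (point2 a) (point2 b) (point2 c))" "P a b c" by blast
  moreover obtain t :: "3 \<Rightarrow> f3" where "t 1 = a" "t 2 = b" "t 3 = c" using ex_triple by metis
  ultimately have "v = \<phi> (pure_tensor t) \<and> P (t 1) (t 2) (t 3)" by (simp add: pure_tensor_def)
  then show "v \<in> {\<phi> (pure_tensor t) | t. P (t 1) (t 2) (t 3)}" by blast
next
  fix v assume "v \<in> {\<phi> (pure_tensor t) | t. P (t 1) (t 2) (t 3)}"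
  then obtain t :: "3 \<Rightarrow> f3" where "v = \<phi> (tensor3 (point2 (t 1)) (point2 (t 2)) (point2 (t 3)))" "P (t 1) (t 2) (t 3)"
    unfolding pure_tensor_def by blast
  then show "v \<in> {\<phi> (tensor3 (point2 a) (point2 b) (point2 c)) | a b c. P a b c}" by blast
qed

subsection \<open>Plane sections\<close>

lemma is_S2_coordinate: "is_S2 \<phi> {\<phi> (pure_tensor t) | t. t n = x}"
proof -
  have eqs: "{\<phi> (pure_tensor t) | t. t 1 = x} = {\<phi> (tensor3 (point2 x) y z) | y z. y \<noteq> 0 \<and> z \<noteq> 0}"
    "{\<phi> (pure_tensor t) | t. t 2 = x} = {\<phi> (tensor3 y (point2 x) z) | y z. y \<noteq> 0 \<and> z \<noteq> 0}"
    "{\<phi> (pure_tensor t) | t. t 3 = x} = {\<phi> (tensor3 y z (point2 x)) | y z. y \<noteq> 0 \<and> z \<noteq> 0}"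
    unfolding nonzero_iff_point2 Collect_pure_tensor[of \<phi> "\<lambda>a b c. a = x"]
      Collect_pure_tensor[of \<phi> "\<lambda>a b c. b = x"]
      Collect_pure_tensor[of \<phi> "\<lambda>a b c. c = x"] by auto
  have "is_S2 \<phi> {\<phi> (pure_tensor t) | t. t 1 = x}" unfolding is_S2_def eqs(1)
    by (intro disjI1 exI[of _ "point2 x"] conjI refl point2_nonzero)
  moreover have "is_S2 \<phi> {\<phi> (pure_tensor t) | t. t 2 = x}" unfolding is_S2_def eqs(2)
    by (intro disjI2[OF disjI1] exI[of _ "point2 x"] conjI refl point2_nonzero)
  moreover have "is_S2 \<phi> {\<phi> (pure_tensor t) | t. t 3 = x}" unfolding is_S2_def eqs(3)
    by (intro disjI2[OF disjI2] exI[of _ "point2 x"] conjI refl point2_nonzero)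
  ultimately show ?thesis using exhaust_3[of n] by auto
qed

text \<open>Residues translate the numbering 1, 2, 3 in \<open>is_three_generator_set\<close> into
  labels from \<open>f3\<close>; \<open>F0\<close> comes from 3, since 0 is outside the
  range.\<close>

lemma nat_f3_onto: "\<exists>r \<in> {1..3}. s = nat_f3 r"
proof (cases s)
  case F0
  then show ?thesis by (intro bexI[of _ 3]) (simp_all add: nat_f3_def)
next
  case F1
  then show ?thesis by (intro bexI[of _ 1]) (simp_all add: nat_f3_def)
next
  case F2
  then show ?thesis by (intro bexI[of _ 2]) (simp_all add: nat_f3_def)
qed

lemma Collect_nat_f3:
  "{F (nat_f3 r) v | r v. r \<in> {1..3} \<and> v \<noteq> 0} = {F s (point2 c) | s c. True}"
proof (intro equalityI subsetI)
  fix x assume "x \<in> {F s (point2 c) | s c. True}"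
  then obtain s c where x: "x = F s (point2 c)" by blast
  obtain r where "r \<in> {1..3}" "s = nat_f3 r" using nat_f3_onto by blast
  then show "x \<in> {F (nat_f3 r) v | r v. r \<in> {1..3} \<and> v \<noteq> 0}" using x point2_nonzero by blast
next
  fix x assume "x \<in> {F (nat_f3 r) v | r v. r \<in> {1..3} \<and> v \<noteq> 0}"
  then obtain r v where "x = F (nat_f3 r) v" "v \<noteq> 0" by blast
  moreover from this(2) obtain c where "v = point2 c" using ex_point2 by metis
  ultimately show "x \<in> {F s (point2 c) | s c. True}" by blast
qed

lemma three_points_point2:
  fixes \<alpha> :: "f3 \<Rightarrow> f3"
  assumes "bij \<alpha>" shows "three_points (\<lambda>r. point2 (\<alpha> (nat_f3 r)))"
proof -
  have "inj_on nat_f3 {1..3}"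
  proof -
    have "{1..3} = {1, 2, 3 :: nat}" by auto
    then show ?thesis by (simp add: nat_f3_def)
  qed
  then show ?thesis using assms
    unfolding three_points_def inj_on_def point2_inject by (auto simp: point2_nonzero bij_def inj_def)
qed

text \<open>Taking either bijection to be the identity gives the graph of the other, in both orders
  of the two coordinates.\<close>

lemma three_generator_aux:
  fixes \<alpha> \<beta> :: "f3 \<Rightarrow> f3"
  assumes "bij \<alpha>" "bij \<beta>"
  shows "is_three_generator_set \<phi> {\<phi> (pure_tensor t) | t. \<exists>s. t 1 = \<alpha> s \<and> t 2 = \<beta> s}"
    "is_three_generator_set \<phi> {\<phi> (pure_tensor t) | t. \<exists>s. t 1 = \<alpha> s \<and> t 3 = \<beta> s}"
    "is_three_generator_set \<phi> {\<phi> (pure_tensor t) | t. \<exists>s. t 2 = \<alpha> s \<and> t 3 = \<beta> s}"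
proof -
  let ?x = "\<lambda>r. point2 (\<alpha> (nat_f3 r))" and ?y = "\<lambda>r. point2 (\<beta> (nat_f3 r))"
  have "{\<phi> (pure_tensor t) | t. \<exists>s. t 1 = \<alpha> s \<and> t 2 = \<beta> s} =
      {\<phi> (tensor3 (?x r) (?y r) v) | r v. r \<in> {1..3} \<and> v \<noteq> 0}"
    "{\<phi> (pure_tensor t) | t. \<exists>s. t 1 = \<alpha> s \<and> t 3 = \<beta> s} =
      {\<phi> (tensor3 (?x r) v (?y r)) | r v. r \<in> {1..3} \<and> v \<noteq> 0}"
    "{\<phi> (pure_tensor t) | t. \<exists>s. t 2 = \<alpha> s \<and> t 3 = \<beta> s} =
      {\<phi> (tensor3 v (?x r) (?y r)) | r v. r \<in> {1..3} \<and> v \<noteq> 0}"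
    unfolding Collect_nat_f3[of "\<lambda>s v. \<phi> (tensor3 (point2 (\<alpha> s)) (point2 (\<beta> s)) v)"]
      Collect_nat_f3[of "\<lambda>s v. \<phi> (tensor3 (point2 (\<alpha> s)) v (point2 (\<beta> s)))"]
      Collect_nat_f3[of "\<lambda>s v. \<phi> (tensor3 v (point2 (\<alpha> s)) (point2 (\<beta> s)))"]
      Collect_pure_tensor[of \<phi> "\<lambda>a b c. \<exists>s. a = \<alpha> s \<and> b = \<beta> s"]
      Collect_pure_tensor[of \<phi> "\<lambda>a b c. \<exists>s. a = \<alpha> s \<and> c = \<beta> s"]
      Collect_pure_tensor[of \<phi> "\<lambda>a b c. \<exists>s. b = \<alpha> s \<and> c = \<beta> s"]
    by auto
  then show "is_three_generator_set \<phi> {\<phi> (pure_tensor t) | t. \<exists>s. t 1 = \<alpha> s \<and> t 2 = \<beta> s}"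
    "is_three_generator_set \<phi> {\<phi> (pure_tensor t) | t. \<exists>s. t 1 = \<alpha> s \<and> t 3 = \<beta> s}"
    "is_three_generator_set \<phi> {\<phi> (pure_tensor t) | t. \<exists>s. t 2 = \<alpha> s \<and> t 3 = \<beta> s}"
    unfolding is_three_generator_set_def
    using three_points_point2[OF assms(1)] three_points_point2[OF assms(2)] by blast+
qed

lemma is_three_generator_set_graph:
  fixes \<delta> :: "f3 \<Rightarrow> f3"
  assumes "bij \<delta>" "m \<noteq> n"
  shows "is_three_generator_set \<phi> {\<phi> (pure_tensor t) | t. t m = \<delta> (t n)}"
proof -
  have graph: "(\<exists>s. t m = \<delta> s \<and> t n = id s) \<longleftrightarrow> t m = \<delta> (t n)"
    "(\<exists>s. t n = id s \<and> t m = \<delta> s) \<longleftrightarrow> t m = \<delta> (t n)" for t :: "3 \<Rightarrow> f3" and m n by auto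
  show ?thesis
    using three_generator_aux[OF assms(1) bij_id, of \<phi>] three_generator_aux[OF bij_id assms(1), of \<phi>]
      exhaust_3[of m] exhaust_3[of n] assms(2) unfolding graph by auto
qed

lemma tensor3_point2_inject:
  "tensor3 (point2 a) (point2 b) (point2 c) = tensor3 (point2 a') (point2 b') (point2 c') \<longleftrightarrow> a = a' \<and> b = b' \<and> c = c'"
proof -
  obtain s t :: "3 \<Rightarrow> f3" where "s 1 = a" "s 2 = b" "s 3 = c" "t 1 = a'" "t 2 = b'" "t 3 = c'"
    using ex_triple by metis
  then show ?thesis using pure_tensor_inject[of s t] by (metis pure_tensor_def)
qed

text \<open>A generator fixes two of the three tensor factors.\<close>

lemma generator_agree:
  assumes "inj \<phi>" "G \<in> generators \<phi>" "\<phi> (pure_tensor s) \<in> G" "\<phi> (pure_tensor t) \<in> G"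
  shows "\<exists>n. \<forall>m. m \<noteq> n \<longrightarrow> s m = t m"
proof -
  have "s 2 = t 2 \<and> s 3 = t 3 \<or> s 1 = t 1 \<and> s 3 = t 3 \<or> s 1 = t 1 \<and> s 2 = t 2"
    using assms(2-4) unfolding generators_def nonzero_iff_point2 pure_tensor_def
    by (auto simp: inj_eq[OF assms(1)] tensor3_point2_inject)
  moreover have "(1::3) \<noteq> 2" "(1::3) \<noteq> 3" "(2::3) \<noteq> 3" by simp_all
  ultimately show ?thesis using exhaust_3 by metis
qed

text \<open>Any two coordinates of a solution determine the third, since every
  \<open>\<gamma> n\<close> is bijective. Hence there are 9 solutions, and two solutions on a common
  generator, which agree outside one coordinate, coincide.\<close>

lemma is_fan_plane:
  fixes \<gamma> :: "3 \<Rightarrow> f3 \<Rightarrow> f3"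
  assumes \<phi>: "inj \<phi>" and \<gamma>: "\<And>n. bij (\<gamma> n)"
  shows "is_fan \<phi> {\<phi> (pure_tensor t) | t. (\<Sum>n\<in>UNIV. \<gamma> n (t n)) = k}"
  unfolding is_fan_def
proof (intro conjI ballI impI)
  let ?X = "{\<phi> (pure_tensor t) | t. (\<Sum>n\<in>UNIV. \<gamma> n (t n)) = k}"
  have inv: "\<gamma> n (inv_into UNIV (\<gamma> n) y) = y" "inv_into UNIV (\<gamma> n) (\<gamma> n y) = y" for n y
    using \<gamma> by (simp_all add: bij_def surj_f_inv_f)
  have \<gamma>_inj: "\<gamma> n x = \<gamma> n y \<longleftrightarrow> x = y" for n x y using \<gamma> by (metis inv(2))
  show "?X \<subseteq> segre_image \<phi>" unfolding segre_image_eq by blast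
  define F where "F = (\<lambda>(a, b).
      \<phi> (tensor3 (point2 a) (point2 b) (point2 (inv_into UNIV (\<gamma> 3) (k - \<gamma> 1 a - \<gamma> 2 b)))))"
  have "?X = range F"
  proof (intro equalityI subsetI)
    fix v assume "v \<in> ?X"
    then obtain t where v: "v = \<phi> (pure_tensor t)" and "\<gamma> 1 (t 1) + \<gamma> 2 (t 2) + \<gamma> 3 (t 3) = k"
      unfolding sum_3 by blast
    then have "\<gamma> 3 (t 3) = k - \<gamma> 1 (t 1) - \<gamma> 2 (t 2)" by (simp add: algebra_simps)
    then have "t 3 = inv_into UNIV (\<gamma> 3) (k - \<gamma> 1 (t 1) - \<gamma> 2 (t 2))" by (metis inv(2))
    then have "v = F (t 1, t 2)" unfolding F_def v pure_tensor_def by simp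
    then show "v \<in> range F" by blast
  next
    fix v assume "v \<in> range F"
    then obtain a b where v: "v = F (a, b)" by auto
    obtain t :: "3 \<Rightarrow> f3" where t: "t 1 = a" "t 2 = b" "t 3 = inv_into UNIV (\<gamma> 3) (k - \<gamma> 1 a - \<gamma> 2 b)"
      using ex_triple by metis
    have "(\<Sum>n\<in>UNIV. \<gamma> n (t n)) = k" unfolding sum_3 t inv by simp
    moreover have "v = \<phi> (pure_tensor t)" unfolding v F_def pure_tensor_def t by simp
    ultimately show "v \<in> ?X" by blast
  qed
  moreover have "inj F" unfolding F_def by (auto simp: inj_def inj_eq[OF \<phi>] tensor3_point2_inject)
  ultimately show "card ?X = 9"
    by (simp add: card_image card_UNIV_f3 flip: UNIV_Times_UNIV)
  fix p q assume "p \<in> ?X" "q \<in> ?X" "p \<noteq> q"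
  show "\<not> (\<exists>G\<in>generators \<phi>. p \<in> G \<and> q \<in> G)"
  proof
    assume "\<exists>G\<in>generators \<phi>. p \<in> G \<and> q \<in> G"
    then obtain G where G: "G \<in> generators \<phi>" "p \<in> G" "q \<in> G" by blast
    from \<open>p \<in> ?X\<close> \<open>q \<in> ?X\<close> obtain s t where p: "p = \<phi> (pure_tensor s)" and q: "q = \<phi> (pure_tensor t)"
      and "\<gamma> 1 (s 1) + \<gamma> 2 (s 2) + \<gamma> 3 (s 3) = k" "\<gamma> 1 (t 1) + \<gamma> 2 (t 2) + \<gamma> 3 (t 3) = k"
      unfolding sum_3 by blast
    moreover obtain n where n: "\<And>m. m \<noteq> n \<Longrightarrow> s m = t m"
      using generator_agree[OF \<phi> G(1)] G p q by blast
    ultimately have "\<gamma> n (s n) = \<gamma> n (t n)"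
      using exhaust_3[of n] n[of 1] n[of 2] n[of 3] by auto
    then have "s = t" using n \<gamma>_inj by (metis ext)
    then show False using \<open>p \<noteq> q\<close> p q by simp
  qed
qed

lemma plane_section:
  fixes g :: "3 \<Rightarrow> f3" and \<eta> :: "3 \<Rightarrow> f3 \<Rightarrow> f3"
  assumes \<phi>: "inj \<phi>" and \<eta>: "\<And>n. bij (\<eta> n)" and g: "\<exists>n. g n \<noteq> 0"
    and X_def: "X = {\<phi> (pure_tensor t) | t. (\<Sum>n\<in>UNIV. g n * \<eta> n (t n)) = k}"
  shows "is_S2 \<phi> X \<or> is_three_generator_set \<phi> X \<or> is_fan \<phi> X"
proof -
  define \<gamma> where "\<gamma> n x = g n * \<eta> n x" for n x
  have \<gamma>: "bij (\<gamma> n)" if "g n \<noteq> 0" for n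
  proof -
    have "inj (\<gamma> n)" using \<eta>[of n] that by (auto simp: inj_def \<gamma>_def bij_def)
    then show ?thesis by (simp add: bij_def finite_UNIV_inj_surj)
  qed
  have \<gamma>0: "\<gamma> n x = 0" if "g n = 0" for n x using that by (simp add: \<gamma>_def)
  have X: "X = {\<phi> (pure_tensor t) | t. \<gamma> 1 (t 1) + \<gamma> 2 (t 2) + \<gamma> 3 (t 3) = k}"
    unfolding X_def sum_3 \<gamma>_def ..
  have inv: "\<gamma> n x = y \<longleftrightarrow> x = inv_into UNIV (\<gamma> n) y" if "g n \<noteq> 0" for n x y
    using \<gamma>[OF that] by (metis bij_inv_eq_iff)
  have one: "is_S2 \<phi> {\<phi> (pure_tensor t) | t. \<gamma> n (t n) = k}" if "g n \<noteq> 0" for n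
    unfolding inv[OF that] by (rule is_S2_coordinate)
  have two: "is_three_generator_set \<phi> {\<phi> (pure_tensor t) | t. \<gamma> m (t m) + \<gamma> n (t n) = k}"
    if "g m \<noteq> 0" "g n \<noteq> 0" "m \<noteq> n" for m n
  proof -
    \<comment> \<open>Solving for \<open>x\<close> exhibits the section as the graph of a
      composition of bijections.\<close>
    have eq: "\<gamma> m x + \<gamma> n y = k \<longleftrightarrow> x = (inv_into UNIV (\<gamma> m) \<circ> (\<lambda>z. k - z) \<circ> \<gamma> n) y" for x y
      by (simp add: inv[OF that(1), symmetric] eq_diff_eq)
    have "bij (\<lambda>z. k - z)" by (rule involuntory_imp_bij) simp
    then have "bij (inv_into UNIV (\<gamma> m) \<circ> (\<lambda>z. k - z) \<circ> \<gamma> n)"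
      by (intro bij_comp \<gamma> that bij_imp_bij_inv)
    then show ?thesis unfolding eq by (rule is_three_generator_set_graph) (rule that)
  qed
  show ?thesis
  proof (cases "g 1 = 0"; cases "g 2 = 0"; cases "g 3 = 0")
    assume "g 1 \<noteq> 0" "g 2 \<noteq> 0" "g 3 \<noteq> 0"
    then have "\<And>n. g n \<noteq> 0" using exhaust_3 by metis
    then have "is_fan \<phi> X" unfolding X sum_3[of "\<lambda>n. \<gamma> n (_ n)", symmetric]
      by (intro is_fan_plane \<phi> \<gamma>)
    then show ?thesis by blast
  next
    assume "g 1 = 0" "g 2 = 0" "g 3 = 0"
    then show ?thesis using g exhaust_3 by metis
  \<comment> \<open>Six cases remain, with exactly one or exactly two nonzero coefficients.\<close>
  qed (use one[of 1] one[of 2] one[of 3] two[of 1 2] two[of 1 3] two[of 2 3] in \<open>simp_all add: X \<gamma>0\<close>)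
qed

subsection \<open>Subgroups as hyperplanes\<close>

lemma dot4_axis: "dot4 g (axis i 1) = g $ i"
  by (simp add: dot4_def axis_def if_distrib[of "\<lambda>x. _ * x"] cong: if_cong)

text \<open>The functional is the coefficient of \<open>a\<close> in the decomposition of a vector
  along \<open>W\<close> and \<open>a\<close>.\<close>

lemma hyperplane_functional:
  fixes W :: "(f3 ^ 4) set"
  assumes W: "vec.subspace W" and a: "a \<notin> W" and sum: "\<And>v. \<exists>s. v - s *s a \<in> W"
  shows "\<exists>g. g \<noteq> 0 \<and> W = {l. dot4 g l = 0}"
proof -
  obtain s where s: "\<And>v. v - s v *s a \<in> W" using sum by metis
  \<comment> \<open>Only the coefficients chosen for the unit vectors are used, so that
    \<open>dot4 g\<close> is linear by construction.\<close>
  define g where "g = (\<chi> i. s (axis i 1))"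
  have "v - dot4 g v *s a = (\<Sum>i\<in>UNIV. v $ i *s (axis i 1 - s (axis i 1) *s a))" for v
    unfolding vec_eq_iff forall_4 by (simp add: dot4_def g_def sum_4 axis_def algebra_simps)
  then have dot4: "v - dot4 g v *s a \<in> W" for v
    using s W by (simp add: vec.subspace_sum vec.subspace_scale)
  have W_iff: "l \<in> W \<longleftrightarrow> dot4 g l = 0" for l
  proof
    assume "l \<in> W"
    with dot4[of l] W have "dot4 g l *s a \<in> W"
      using vec.subspace_diff[OF W, of l "l - dot4 g l *s a"] by simp
    \<comment> \<open>If \<open>dot4 g l\<close> were nonzero, its square would be 1 and
      \<open>a\<close> would lie in \<open>W\<close>.\<close>
    then have "(dot4 g l * dot4 g l) *s a \<in> W"
      using vec.subspace_scale[OF W] by (metis vec.scale_scale)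
    then show "dot4 g l = 0" using a f3_square by (metis vec.scale_one)
  next
    assume "dot4 g l = 0"
    then show "l \<in> W" using dot4[of l] by simp
  qed
  moreover have "g \<noteq> 0"
  proof
    assume "g = 0"
    then have "dot4 g a = 0" by (simp add: dot4_def)
    with a W_iff show False by simp
  qed
  ultimately show ?thesis by blast
qed

text \<open>Adjoining a unit vector to the 3-dimensional \<open>V\<close> fills the space, so
  \<open>V\<close> is the kernel of a functional; its \<open>i\<close>-th coefficient is its value
  at the \<open>i\<close>-th unit vector, which lies outside \<open>V\<close>.\<close>

lemma kind_P0_functional:
  assumes "kind_P0 V"
  shows "\<exists>f. (\<forall>i. f $ i \<noteq> 0) \<and> V = {l. dot4 f l = 0}"
proof -
  have V: "vec.subspace V" "vec.dim V = 3" and ax: "\<And>i. axis i 1 \<notin> V"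
    using assms by (auto simp: kind_P0_def)
  let ?a = "axis 1 1 :: f3 ^ 4"
  have "?a \<notin> vec.span V" using ax vec.span_eq_iff V(1) by metis
  then have "vec.dim (insert ?a V) = 4" using V(2) by (simp add: vec.dim_insert)
  then have "vec.span (insert ?a V) = UNIV"
    using vec.dim_eq_full[of "insert ?a V"] by (simp add: vec.dimension_def card_cart_basis)
  then have "\<exists>s. v - s *s ?a \<in> V" for v
    using vec.span_breakdown_eq[of v ?a V] vec.span_eq_iff V(1) by (metis UNIV_I)
  then obtain f where f: "V = {l. dot4 f l = 0}" using hyperplane_functional[OF V(1) ax] by metis
  moreover have "f $ i \<noteq> 0" for i using ax[of i] unfolding f by (simp add: dot4_axis)
  ultimately show ?thesis by blast
qed

lemma f3_double: "F0 * x = 0" "F1 * x = x" "F2 * x = x + x"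
  by (cases x; simp add: f3_defs)+

text \<open>Over the prime field, closure under addition already makes \<open>W\<close> a subspace.
  For \<open>a\<close> outside \<open>W\<close>, the 27 * 3 vectors \<open>l + s *s a\<close> are
  distinct, so they exhaust the 81 vectors.\<close>

lemma card_27_functional:
  fixes W :: "(f3 ^ 4) set"
  assumes add: "\<And>l m. l \<in> W \<Longrightarrow> m \<in> W \<Longrightarrow> l + m \<in> W" and card: "card W = 27"
  shows "\<exists>g. g \<noteq> 0 \<and> W = {l. dot4 g l = 0}"
proof -
  obtain l where "l \<in> W" using card by (metis card.empty equals0I zero_neq_numeral)
  then have "l + l + l \<in> W" using add by blast
  moreover have "l + l + l = 0" by (simp only: vec_eq_iff vector_add_component f3_three zero_index simp_thms)
  ultimately have "0 \<in> W" by simp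
  moreover have "c *s l \<in> W" if "l \<in> W" for c l
  proof -
    have "F0 *s l = 0" "F1 *s l = l" "F2 *s l = l + l"
      by (simp_all only: vec_eq_iff vector_smult_component vector_add_component zero_index)
        (simp_all add: f3_double)
    then show ?thesis using \<open>0 \<in> W\<close> that add by (cases c) metis+
  qed
  ultimately have W: "vec.subspace W" using add by (simp add: vec.subspace_def)
  have "W \<noteq> UNIV" using card by (auto simp: card_UNIV_f3)
  then obtain a where a: "a \<notin> W" by blast
  define F where "F = (\<lambda>(l, s). l + s *s a)"
  have "inj_on F (W \<times> UNIV)"
  proof (rule inj_onI, clarify)
    fix l s m t assume *: "l \<in> W" "m \<in> W" "F (l, s) = F (m, t)"
    then have "(s - t) *s a = m - l" unfolding F_def
      by (simp add: vec.scale_left_diff_distrib algebra_simps)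
    then have "(s - t) *s a \<in> W" using * vec.subspace_diff[OF W] by simp
    then have "((s - t) * (s - t)) *s a \<in> W" using vec.subspace_scale[OF W] by (metis vec.scale_scale)
    then have "s = t" using a f3_square[of "s - t"] by (metis eq_iff_diff_eq_0 vec.scale_one)
    then show "l = m \<and> s = t" using * by (simp add: F_def)
  qed
  then have "card (F ` (W \<times> UNIV)) = CARD(f3 ^ 4)"
    using card by (simp add: card_image card_cartesian_product card_UNIV_f3)
  then have "F ` (W \<times> UNIV) = UNIV" by (intro card_subset_eq) simp_all
  then have "\<exists>s. v - s *s a \<in> W" for v
  proof -
    assume "F ` (W \<times> UNIV) = UNIV"
    then have "v \<in> F ` (W \<times> UNIV)" by simp
    then obtain l s where "l \<in> W" "v = l + s *s a" by (auto simp: F_def)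
    then show ?thesis by (metis add_diff_cancel_right')
  qed
  then show ?thesis using hyperplane_functional[OF W a] by blast
qed

lemma coset_orbits_image:
  assumes "S \<in> coset_orbits (A ` V)"
  shows "\<exists>c. S = {A (l + c) u | l. l \<in> V}"
proof -
  obtain c where "S = (\<lambda>h. h u) ` (A ` V #>\<^bsub>G81\<^esub> A c)"
    using assms by (auto simp: coset_orbits_def RCOSETS_def G81_def)
  then have "S = (\<lambda>l. A l (A c u)) ` V"
    by (simp add: r_coset_def G81_def UNION_singleton_eq_range image_image)
  then show ?thesis unfolding A_comp_u by blast
qed

lemma coset_orbits_level_set:
  assumes "S \<in> coset_orbits (A ` {l. dot4 f l = 0})"
  shows "\<exists>c. S = {A l u | l. dot4 f l = dot4 f c}"
proof -
  obtain c where S: "S = {A (l + c) u | l. dot4 f l = 0}"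
    using coset_orbits_image[OF assms] by auto
  have "S = {A l u | l. dot4 f l = dot4 f c}"
  proof (intro equalityI subsetI)
    fix v assume "v \<in> {A l u | l. dot4 f l = dot4 f c}"
    then obtain l where "v = A (l - c + c) u" "dot4 f (l - c) = 0" by (auto simp: dot4_diff)
    then show "v \<in> S" unfolding S by blast
  qed (auto simp: S dot4_add)
  then show ?thesis ..
qed

text \<open>The exponents of the maps in \<open>K\<close> are closed under addition because
  \<open>K\<close> is closed under composition, and there are 27 of them because the isomorphism
  fixes the order of \<open>K\<close>.\<close>

lemma is_Z3_cubed_functional:
  assumes "is_Z3_cubed K"
  shows "\<exists>g. g \<noteq> 0 \<and> K = A ` {l. dot4 g l = 0}"
proof -
  have sub: "subgroup K G81" and iso: "G81\<lparr>carrier := K\<rparr> \<cong>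
      integer_mod_group 3 \<times>\<times> integer_mod_group 3 \<times>\<times> integer_mod_group 3"
    using assms by (auto simp: is_Z3_cubed_def)
  define W where "W = {l. A l \<in> K}"
  have K: "K = A ` W" using subgroup.subset[OF sub] by (auto simp: W_def G81_def)
  have add: "l + m \<in> W" if "l \<in> W" "m \<in> W" for l m
  proof -
    have "A l \<circ> A m \<in> K" using subgroup.m_closed[OF sub, of "A l" "A m"] that by (simp add: W_def G81_def)
    moreover from this obtain n where n: "A l \<circ> A m = A n" using K by blast
    moreover have "n = l + m" using fun_cong[OF n, of u] by (simp add: A_comp_u A_u_inject)
    ultimately show ?thesis by (simp add: W_def)
  qed
  have "card K = 27"
    using iso_same_card[OF iso] by (simp add: DirProd_def card_cartesian_product carrier_integer_mod_group)
  moreover have "inj_on A W" by (rule inj_onI) (metis A_u_inject)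
  ultimately have "card W = 27" unfolding K by (simp add: card_image)
  then show ?thesis using card_27_functional[OF add] K by metis
qed

section \<open>The section as a plane in affine coordinates\<close>

lemma section_is_plane:
  assumes f: "\<forall>i. f $ i \<noteq> 0" and g: "g \<noteq> 0" and ne: "{l. dot4 g l = 0} \<noteq> {l. dot4 f l = 0}"
  shows "\<exists>h k. (\<exists>m. h m \<noteq> 0) \<and> {A l u | l. dot4 f l = dot4 f c} \<inter> {A l u | l. dot4 g l = dot4 g d} =
    {segre_map f c (pure_tensor t) | t. (\<Sum>m\<in>UNIV. h m * t m) = k}"
proof -
  \<comment> \<open>These are the coefficients of \<open>dot4 g\<close>, up to a constant, in the
    affine coordinates of the coset.\<close>
  define h where "h m = dot4 g (direction f m)" for m
  have affine_point: "dot4 g (affine_point f b t) = dot4 g b + (\<Sum>m\<in>UNIV. h m * t m)" for b t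
    unfolding affine_point_def sum_3 h_def by (simp add: dot4_add dot4_scale mult.commute)
  have "\<exists>m. h m \<noteq> 0"
  proof (rule ccontr)
    assume "\<not> (\<exists>m. h m \<noteq> 0)"
    then have kernel: "dot4 g l = 0" if "dot4 f l = 0" for l
      using ex_affine_point[OF f, of l 0] affine_point[of 0] that by (auto simp: dot4_def)
    \<comment> \<open>The kernel of \<open>f\<close> now lies in that of \<open>g\<close>; as the
      kernels differ, that of \<open>g\<close> has a further vector \<open>a\<close>, and the two
      together span everything, which forces \<open>g = 0\<close>.\<close>
    then obtain a where a: "dot4 g a = 0" "dot4 f a \<noteq> 0" using ne by blast
    have "dot4 g v = 0" for v
    proof -
      have "dot4 f (v - (dot4 f v * dot4 f a) *s a) = 0"
        using f3_square[OF a(2)] by (simp add: dot4_diff dot4_scale mult.assoc)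
      from kernel[OF this] a(1) show ?thesis by (simp add: dot4_diff dot4_scale)
    qed
    then have "g = 0" by (metis dot4_axis vec_eq_iff zero_index)
    with g show False ..
  qed
  moreover have "{A l u | l. dot4 f l = dot4 f c} \<inter> {A l u | l. dot4 g l = dot4 g d} =
      {segre_map f c (pure_tensor t) | t. (\<Sum>m\<in>UNIV. h m * t m) = dot4 g d - dot4 g c}"
  proof (intro equalityI subsetI)
    fix v assume "v \<in> {A l u | l. dot4 f l = dot4 f c} \<inter> {A l u | l. dot4 g l = dot4 g d}"
    then obtain l where l: "v = A l u" "dot4 f l = dot4 f c" "dot4 g l = dot4 g d"
      by (auto simp: A_u_inject)
    then obtain t where t: "l = affine_point f c t" using ex_affine_point[OF f] by blast
    then have "(\<Sum>m\<in>UNIV. h m * t m) = dot4 g d - dot4 g c"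
      using affine_point[of c t] l(3) by (simp add: algebra_simps)
    moreover have "v = segre_map f c (pure_tensor t)" using l(1) t by (simp add: segre_map_pure_tensor[OF f])
    ultimately show "v \<in> {segre_map f c (pure_tensor t) | t. (\<Sum>m\<in>UNIV. h m * t m) = dot4 g d - dot4 g c}" by blast
  next
    fix v assume "v \<in> {segre_map f c (pure_tensor t) | t. (\<Sum>m\<in>UNIV. h m * t m) = dot4 g d - dot4 g c}"
    then obtain t where "v = A (affine_point f c t) u" "dot4 g (affine_point f c t) = dot4 g d"
      using affine_point[of c] by (auto simp: segre_map_pure_tensor[OF f])
    then show "v \<in> {A l u | l. dot4 f l = dot4 f c} \<inter> {A l u | l. dot4 g l = dot4 g d}"
      using dot4_affine_point[OF f, of c t] by blast
  qed
  ultimately show ?thesis by blast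
qed

text \<open>The relabellings \<open>\<eta> n\<close> are absorbed into the equation; this is why
  \<open>plane_section\<close> allows an arbitrary bijection in each coordinate.\<close>

lemma plane_transfer:
  fixes \<tau> :: "3 \<Rightarrow> 3" and h :: "3 \<Rightarrow> f3"
  assumes \<tau>: "bij \<tau>" and \<eta>: "\<And>n. bij (\<eta> n)"
    and eq: "\<And>s. \<psi> (pure_tensor s) = \<phi> (pure_tensor (\<lambda>n. \<eta> n (s (\<tau> n))))"
  shows "{\<psi> (pure_tensor s) | s. (\<Sum>m\<in>UNIV. h m * s m) = k} =
    {\<phi> (pure_tensor t) | t. (\<Sum>n\<in>UNIV. h (\<tau> n) * inv_into UNIV (\<eta> n) (t n)) = k}"
proof -
  have inv: "inv_into UNIV (\<eta> n) (\<eta> n x) = x" "\<eta> n (inv_into UNIV (\<eta> n) x) = x" for n x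
    using \<eta> by (simp_all add: bij_def surj_f_inv_f)
  have sum: "(\<Sum>m\<in>UNIV. h m * s m) = (\<Sum>n\<in>UNIV. h (\<tau> n) * s (\<tau> n))" for s
    by (rule sum.reindex_bij_betw[OF \<tau>, symmetric])
  show ?thesis
  proof (intro equalityI subsetI)
    fix v assume "v \<in> {\<psi> (pure_tensor s) | s. (\<Sum>m\<in>UNIV. h m * s m) = k}"
    then obtain s where s: "v = \<psi> (pure_tensor s)" "(\<Sum>m\<in>UNIV. h m * s m) = k" by blast
    let ?t = "\<lambda>n. \<eta> n (s (\<tau> n))"
    have "v = \<phi> (pure_tensor ?t)" "(\<Sum>n\<in>UNIV. h (\<tau> n) * inv_into UNIV (\<eta> n) (?t n)) = k"
      using s by (simp_all only: eq inv sum)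
    then show "v \<in> {\<phi> (pure_tensor t) | t. (\<Sum>n\<in>UNIV. h (\<tau> n) * inv_into UNIV (\<eta> n) (t n)) = k}" by blast
  next
    fix v assume "v \<in> {\<phi> (pure_tensor t) | t. (\<Sum>n\<in>UNIV. h (\<tau> n) * inv_into UNIV (\<eta> n) (t n)) = k}"
    then obtain t where t: "v = \<phi> (pure_tensor t)" "(\<Sum>n\<in>UNIV. h (\<tau> n) * inv_into UNIV (\<eta> n) (t n)) = k" by blast
    define s where "s m = (let n = inv_into UNIV \<tau> m in inv_into UNIV (\<eta> n) (t n))" for m
    have s: "s (\<tau> n) = inv_into UNIV (\<eta> n) (t n)" for n
      using \<tau> by (simp add: s_def bij_def)
    have "v = \<psi> (pure_tensor s)" "(\<Sum>m\<in>UNIV. h m * s m) = k"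
      using t by (simp_all only: eq inv sum s)
    then show "v \<in> {\<psi> (pure_tensor s) | s. (\<Sum>m\<in>UNIV. h m * s m) = k}" by blast
  qed
qed

theorem theorem9:
  fixes V3 :: "(f3 ^ 4) set" and H K :: "(V8 \<Rightarrow> V8) set" and S R :: "V8 set"
  assumes "kind_P0 V3" and "H = A ` V3" and "S \<in> coset_orbits H"
    and "is_Z3_cubed K" and "K \<noteq> H" and "R \<in> coset_orbits K"
  shows "S \<subseteq> omega4 \<and> (\<exists>\<phi>. segre_param \<phi> S) \<and>
    (\<forall>\<phi>. segre_param \<phi> S \<longrightarrow>
       is_S2 \<phi> (S \<inter> R) \<or> is_three_generator_set \<phi> (S \<inter> R) \<or> is_fan \<phi> (S \<inter> R))"
proof -
  obtain f where f: "\<forall>i. f $ i \<noteq> 0" and V3: "V3 = {l. dot4 f l = 0}"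
    using kind_P0_functional[OF assms(1)] by blast
  obtain g where g: "g \<noteq> 0" and K: "K = A ` {l. dot4 g l = 0}"
    using is_Z3_cubed_functional[OF assms(4)] by blast
  obtain c where S: "S = {A l u | l. dot4 f l = dot4 f c}"
    using coset_orbits_level_set[of S f] assms(2,3) unfolding V3 by blast
  obtain d where R: "R = {A l u | l. dot4 g l = dot4 g d}"
    using coset_orbits_level_set[of R g] assms(6) unfolding K by blast
  have "{l. dot4 g l = 0} \<noteq> {l. dot4 f l = 0}" using assms(2,5) unfolding K V3 by metis
  then obtain h k where h: "\<exists>m. h m \<noteq> 0"
    and SR: "S \<inter> R = {segre_map f c (pure_tensor t) | t. (\<Sum>m\<in>UNIV. h m * t m) = k}"
    using section_is_plane[OF f g, of c d] unfolding S R by blast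
  have \<psi>: "segre_param (segre_map f c) S" unfolding S by (rule segre_param_segre_map[OF f])
  have "is_S2 \<phi> (S \<inter> R) \<or> is_three_generator_set \<phi> (S \<inter> R) \<or> is_fan \<phi> (S \<inter> R)"
    if \<phi>: "segre_param \<phi> S" for \<phi>
  proof -
    \<comment> \<open>The section is a plane in the coordinates of \<open>segre_map f c\<close>; it
      has to be rewritten in those of the given \<open>\<phi>\<close>.\<close>
    obtain \<tau> \<eta> where \<tau>: "bij \<tau>" and \<eta>: "\<And>n. bij (\<eta> n)"
      and eq: "\<And>s. segre_map f c (pure_tensor s) = \<phi> (pure_tensor (\<lambda>n. \<eta> n (s (\<tau> n))))"
      using segre_param_transfer[OF \<phi> \<psi>] by metis
    \<comment> \<open>\<open>\<tau>\<close> only permutes the coefficients, so a nonzero one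
      survives.\<close>
    have "\<exists>n. h (\<tau> n) \<noteq> 0" using h \<tau> by (metis bij_pointE)
    moreover have "inj \<phi>" using \<phi> by (simp add: segre_param_def bij_def)
    moreover have "bij (inv_into UNIV (\<eta> n))" for n using \<eta> by (simp add: bij_imp_bij_inv)
    ultimately show ?thesis
      unfolding SR plane_transfer[of \<tau> \<eta> "segre_map f c" \<phi> h k, OF \<tau> \<eta> eq] by (intro plane_section[OF _ _ _ refl]) auto
  qed
  moreover have "S \<subseteq> omega4" unfolding S using A_u_in_omega4 by blast
  ultimately show ?thesis using \<psi> by blast
qed

end
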